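(* There exists a stochastic process $$\bigl(B^{h\sigma}(x,y):x,y\in\mathbb Z^2,\ h\in\mathcal H,\ \sigma\in\{+,-\}\bigr)$$ on $(\Omega,\mathcal F,\mathbb P)$ with the following properties: (a) (No $\pm$ distinction at fixed $h$) For each $h\in\mathcal H$, $\mathbb P\{B^{h-}=B^{h+}\}=1$. When $B^{h-}(\omega)=B^{h+}(\omega)$, call the common cocycle $B^h(\omega)$. (b) (Forward measurable Busemann function) For each $h\in\mathcal H$, $B^h\in\mathcal K_c^+$. (c) (Mean $-h$) For each $h\in\mathcal H$ and $i\in\{1,2\}$, $\mathbb E[B^h(0,e_i)]=-h\cdot e_i$. (d) (Monotonicity) For $h,h'\in\mathcal H$ with $h\cdot e_1\le h'\cdot e_1$, all $x\in\mathbb Z^2$, and $\mathbb P$-almost every $\omega$, $$B^{h-}(x,x+e_1)\ge B^{h+}(x,x+e_1)\ge B^{h'-}(x,x+e_1)\ge B^{h'+}(x,x+e_1)$$ and $$B^{h-}(x,x+e_2)\le B^{h+}(x,x+e_2)\le B^{h'-}(x,x+e_2)\le B^{h'+}(x,x+e_2).$$ (e) (Left-/right-continuity) For $\mathbb P$-almost all $\omega$, all $h\in\mathcal H$, and all $x,y\in\mathbb Z^2$, $$B^{h-}(x,y)=\lim_{\mathcal H\ni h'\to h,\ h'\cdot e_1\nearrow h\cdot e_1}B^{h'\pm}(x,y)\quad\text{and}\quad B^{h+}(x,y)=\lim_{\mathcal H\ni h'\to h,\ h'\cdot e_1\searrow h\cdot e_1}B^{h'\pm}(x,y),$$ where each limit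 holds for either choice of the sign $\pm$. Moreover, this process is unique in the sense that any two processes satisfying (a)--(e) are equal almost surely.
   Context: $\Omega=\mathbb R^{\mathbb Z^2}$ with its Borel $\sigma$-algebra $\mathcal F$, generic element $\omega=(\omega_x)_{x\in\mathbb Z^2}$, shifts $(T_z\omega)_x=\omega_{x+z}$. $\mathbb P$ is a product probability measure on $\Omega$ under which the $\omega_x$ are i.i.d. with $\mathbb E[|\omega_0|^{2+\epsilon}]<\infty$ for some $\epsilon>0$ and $\mathbb E[\omega_0^2]>\mathbb E[\omega_0]^2$. For $u\in\mathbb Z^2$, $\mathcal F_u^+$ is the $\sigma$-algebra generated by $\{\omega_y:y-u\in\mathbb Z_+^2\}$, $\mathbb Z_+=\{0,1,2,\dots\}$. $e_1=(1,0)$, $e_2=(0,1)$. A function $b:\mathbb Z^2\times\mathbb Z^2\to\mathbb R$ is a cocycle if $b(x,y)+b(y,z)=b(x,z)$ for all $x,y,z$; it recovers the weights $\omega$ if $\min\{b(x,x+e_1),b(x,x+e_2)\}=\omega_x$ for all $x$. $\mathcal K$ is the collection of measurable functions $B:\Omega\times\mathbb Z^2\times\mathbb Z^2\to\mathbb R$ such that: $\mathbb P$-a.s. $B(\omega,\cdot,\cdot)$ is a cocycle recovering $\omega$; $\mathbb P$-a.s. $B(\omega,x+z,y+z)=B(T_z\omega,x,y)$ for all $x,y,z$; and $\mathbb E[|B(x,y)|]<\infty$ for all $x,y$. For $B\in\mathcal K$, $\mathbf h(B)\in\mathbb R^2$ is the deterministic vector with $\mathbf h(B)\cdot e_i=-\mathbb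 E[B(0,e_i)]$, $i\in\{1,2\}$. For $u\in\mathbb Z^2$ let $x^{B,u}(\omega)$ be the semi-infinite path started at $u$ which from each visited site $x$ steps to $x+e_1$ if $B(\omega,x,x+e_1)\le B(\omega,x,x+e_2)$ and to $x+e_2$ otherwise. Up-right paths are indexed by antidiagonal level, $\pi_i\cdot(e_1+e_2)=i$; two semi-infinite up-right paths coalesce if they agree at all sufficiently large levels. $\mathcal K_c\subset\mathcal K$ is the set of those $B$ for which, $\mathbb P$-a.s., $x^{B,u}$ and $x^{B,v}$ coalesce for all $u,v\in\mathbb Z^2$. $B\in\mathcal K$ is forward measurable if for all $u\in\mathbb Z^2$ and $x,y\in u+\mathbb Z_+^2$ the map $\omega\mapsto B(\omega,x,y)$ is $\mathcal F_u^+$-measurable; $\mathcal K_c^+$ is the set of forward measurable elements of $\mathcal K_c$. The set of tilts is $\mathcal H=\{\mathbf h(B):B\in\mathcal K_c\}\subset\mathbb R^2$. One-sided limits in $h'$ are taken over $h'\in\mathcal H$ with $h'\cdot e_1<h\cdot e_1$ (resp. $h'\cdot e_1>h\cdot e_1$), and each limit identity is asserted at those $h$ which are accumulation points of $\mathcal H$ from the corresponding side. Equality almost surely of two processes means that, on an event of probability one, they agree for all $x,y\in\mathbb Z^2$, $h\in\mathcal H$, $\sigma\in\{+,-\}$. *)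

theory Defs
  imports "HOL-Probability.Probability"
begin

type_synonym site = "int \<times> int"
type_synonym env = "site \<Rightarrow> real"

text \<open>
  The unit vectors are polymorphic, so that \<open>x + e1\<close> is meaningful for a lattice site \<open>x\<close>
  and \<open>h \<bullet> e1\<close> for a vector \<open>h\<close> of the real plane.
\<close>

abbreviation e1 :: "'a::{zero,one} \<times> 'a" where "e1 \<equiv> (1, 0)"
abbreviation e2 :: "'a::{zero,one} \<times> 'a" where "e2 \<equiv> (0, 1)"

definition shift :: "site \<Rightarrow> env \<Rightarrow> env" where
  "shift z \<omega> = (\<lambda>x. \<omega> (x + z))"

definition quadrant :: "site set" where
  "quadrant = {(a, b). 0 \<le> a \<and> 0 \<le> b}"

definition forward_algebra :: "site \<Rightarrow> env measure" where
  "forward_algebra u = sigma UNIV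
     {(\<lambda>\<omega>. \<omega> y) -` A | y A. y - u \<in> quadrant \<and> A \<in> sets (borel :: real measure)}"

definition cocycle :: "(site \<Rightarrow> site \<Rightarrow> real) \<Rightarrow> bool" where
  "cocycle b \<longleftrightarrow> (\<forall>x y z. b x y + b y z = b x z)"

definition recovers :: "(site \<Rightarrow> site \<Rightarrow> real) \<Rightarrow> env \<Rightarrow> bool" where
  "recovers b \<omega> \<longleftrightarrow> (\<forall>x. min (b x (x + e1)) (b x (x + e2)) = \<omega> x)"

text \<open>
  In all that follows \<open>P\<close> is the law of the environment; measurability with respect to \<open>P\<close>
  is with respect to the uncompleted product Borel sigma-algebra.
\<close>

definition cocycle_class :: "env measure \<Rightarrow> (env \<Rightarrow> site \<Rightarrow> site \<Rightarrow> real) set" where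
  "cocycle_class P = {B.
     (\<lambda>(\<omega>, x, y). B \<omega> x y) \<in> borel_measurable (P \<Otimes>\<^sub>M count_space UNIV) \<and>
     (AE \<omega> in P. cocycle (B \<omega>) \<and> recovers (B \<omega>) \<omega>) \<and>
     (AE \<omega> in P. \<forall>x y z. B \<omega> (x + z) (y + z) = B (shift z \<omega>) x y) \<and>
     (\<forall>x y. integrable P (\<lambda>\<omega>. B \<omega> x y))}"

definition tilt :: "env measure \<Rightarrow> (env \<Rightarrow> site \<Rightarrow> site \<Rightarrow> real) \<Rightarrow> real \<times> real" where
  "tilt P B = (- (\<integral>\<omega>. B \<omega> 0 e1 \<partial>P), - (\<integral>\<omega>. B \<omega> 0 e2 \<partial>P))"

primrec walk :: "(site \<Rightarrow> site \<Rightarrow> real) \<Rightarrow> site \<Rightarrow> nat \<Rightarrow> site" where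
  "walk b u 0 = u"
| "walk b u (Suc n) =
     (let x = walk b u n in if b x (x + e1) \<le> b x (x + e2) then x + e1 else x + e2)"

definition level :: "site \<Rightarrow> int" where
  "level x = fst x + snd x"

text \<open>
  The path from \<open>u\<close> indexed by antidiagonal level. Only the values at \<open>i \<ge> level u\<close> are
  meaningful; the others are never relevant, since coalescence concerns large levels only.
\<close>

definition level_path :: "(site \<Rightarrow> site \<Rightarrow> real) \<Rightarrow> site \<Rightarrow> int \<Rightarrow> site" where
  "level_path b u i = walk b u (nat (i - level u))"

lemma level_level_path:
  assumes "level u \<le> i"
  shows "level (level_path b u i) = i"
proof -
  have "level (walk b u n) = level u + int n" for n
    by (induction n) (auto simp: level_def Let_def)
  then show ?thesis using assms by (simp add: level_path_def)
qed

definition coalesce :: "(int \<Rightarrow> site) \<Rightarrow> (int \<Rightarrow> site) \<Rightarrow> bool" where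
  "coalesce \<pi> \<pi>' \<longleftrightarrow> (\<exists>N. \<forall>i\<ge>N. \<pi> i = \<pi>' i)"

definition coalescing_class :: "env measure \<Rightarrow> (env \<Rightarrow> site \<Rightarrow> site \<Rightarrow> real) set" where
  "coalescing_class P = {B \<in> cocycle_class P.
     AE \<omega> in P. \<forall>u v. coalesce (level_path (B \<omega>) u) (level_path (B \<omega>) v)}"

definition forward_measurable :: "(env \<Rightarrow> site \<Rightarrow> site \<Rightarrow> real) \<Rightarrow> bool" where
  "forward_measurable B \<longleftrightarrow>
     (\<forall>u x y. x - u \<in> quadrant \<longrightarrow> y - u \<in> quadrant \<longrightarrow>
        (\<lambda>\<omega>. B \<omega> x y) \<in> borel_measurable (forward_algebra u))"

definition forward_coalescing_class :: "env measure \<Rightarrow> (env \<Rightarrow> site \<Rightarrow> site \<Rightarrow> real) set" where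
  "forward_coalescing_class P = {B \<in> coalescing_class P. forward_measurable B}"

definition tilts :: "env measure \<Rightarrow> (real \<times> real) set" where
  "tilts P = tilt P ` coalescing_class P"

definition tilts_left :: "env measure \<Rightarrow> real \<times> real \<Rightarrow> (real \<times> real) set" where
  "tilts_left P h = {h' \<in> tilts P. h' \<bullet> e1 < h \<bullet> e1}"

definition tilts_right :: "env measure \<Rightarrow> real \<times> real \<Rightarrow> (real \<times> real) set" where
  "tilts_right P h = {h' \<in> tilts P. h' \<bullet> e1 > h \<bullet> e1}"

datatype side = Minus | Plus

type_synonym process = "real \<times> real \<Rightarrow> side \<Rightarrow> env \<Rightarrow> site \<Rightarrow> site \<Rightarrow> real"

text \<open>
  \<open>common_cocycle B h C\<close>: \<open>C\<close> is the cocycle \<open>B\<^sup>h\<close>, i.e. the common value of \<open>B h Minus\<close>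
  and \<open>B h Plus\<close> wherever these agree. Where they differ \<open>B\<^sup>h\<close> carries no meaning, and \<open>C\<close> is
  unconstrained there.
\<close>

definition common_cocycle ::
    "process \<Rightarrow> real \<times> real \<Rightarrow> (env \<Rightarrow> site \<Rightarrow> site \<Rightarrow> real) \<Rightarrow> bool" where
  "common_cocycle B h C \<longleftrightarrow>
     (\<forall>\<omega>. B h Minus \<omega> = B h Plus \<omega> \<longrightarrow> C \<omega> = B h Minus \<omega> \<and> C \<omega> = B h Plus \<omega>)"

definition no_sign_distinction :: "env measure \<Rightarrow> process \<Rightarrow> bool" where
  "no_sign_distinction P B \<longleftrightarrow> (\<forall>h\<in>tilts P. AE \<omega> in P. B h Minus \<omega> = B h Plus \<omega>)"

definition busemann_with_mean :: "env measure \<Rightarrow> process \<Rightarrow> bool" where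
  "busemann_with_mean P B \<longleftrightarrow>
     (\<forall>h\<in>tilts P. \<exists>C. common_cocycle B h C \<and>
        C \<in> forward_coalescing_class P \<and>
        (\<integral>\<omega>. C \<omega> 0 e1 \<partial>P) = - (h \<bullet> e1) \<and>
        (\<integral>\<omega>. C \<omega> 0 e2 \<partial>P) = - (h \<bullet> e2))"

text \<open>
  In the monotonicity property the exceptional null set may depend on \<open>h\<close>, \<open>h'\<close> and \<open>x\<close>
  (for \<open>h = h'\<close> a null set common to all \<open>h\<close> would exclude every discontinuity); in the
  one-sided continuity property it may not.
\<close>

definition monotone_process :: "env measure \<Rightarrow> process \<Rightarrow> bool" where
  "monotone_process P B \<longleftrightarrow>
     (\<forall>h\<in>tilts P. \<forall>h'\<in>tilts P. h \<bullet> e1 \<le> h' \<bullet> e1 \<longrightarrow> (\<forall>x. AE \<omega> in P.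
        B h Minus \<omega> x (x + e1) \<ge> B h Plus \<omega> x (x + e1) \<and>
        B h Plus \<omega> x (x + e1) \<ge> B h' Minus \<omega> x (x + e1) \<and>
        B h' Minus \<omega> x (x + e1) \<ge> B h' Plus \<omega> x (x + e1) \<and>
        B h Minus \<omega> x (x + e2) \<le> B h Plus \<omega> x (x + e2) \<and>
        B h Plus \<omega> x (x + e2) \<le> B h' Minus \<omega> x (x + e2) \<and>
        B h' Minus \<omega> x (x + e2) \<le> B h' Plus \<omega> x (x + e2)))"

definition one_sided_continuous :: "env measure \<Rightarrow> process \<Rightarrow> bool" where
  "one_sided_continuous P B \<longleftrightarrow>
     (AE \<omega> in P. \<forall>h\<in>tilts P. \<forall>x y. \<forall>s.
        (h islimpt tilts_left P h \<longrightarrow>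
           ((\<lambda>h'. B h' s \<omega> x y) \<longlongrightarrow> B h Minus \<omega> x y) (at h within tilts_left P h)) \<and>
        (h islimpt tilts_right P h \<longrightarrow>
           ((\<lambda>h'. B h' s \<omega> x y) \<longlongrightarrow> B h Plus \<omega> x y) (at h within tilts_right P h)))"

definition busemann_process :: "env measure \<Rightarrow> process \<Rightarrow> bool" where
  "busemann_process P B \<longleftrightarrow>
     (\<forall>h\<in>tilts P. \<forall>s x y. (\<lambda>\<omega>. B h s \<omega> x y) \<in> borel_measurable P) \<and>
     no_sign_distinction P B \<and>
     busemann_with_mean P B \<and>
     monotone_process P B \<and>
     one_sided_continuous P B"

end

theory Submission imports Defs begin

text \<open>
  A cocycle \<open>b\<close> that recovers \<open>\<omega>\<close> is a last-passage increment along its own paths: \<open>b x y\<close>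
  is the weight of the \<open>b\<close>-path from \<open>x\<close> to any later point \<open>y\<close> of that path, and every
  other such cocycle \<open>b'\<close> is at least that weight at \<open>x\<close>, \<open>y\<close>. Hence if the \<open>b\<close>-path from \<open>x\<close> meets
  the \<open>b'\<close>-path from \<open>x + e1\<close> at \<open>p\<close>, then \<open>b x p \<le> b' x p\<close> and
  \<open>b' (x + e1) p \<le> b (x + e1) p\<close>, so \<open>b x (x + e1) \<le> b' x (x + e1)\<close>. By planarity the two
  paths do meet when the \<open>b\<close>-paths are, at arbitrarily large levels, weakly to the right of the
  \<open>b'\<close>-paths; by coalescence this condition does not depend on the starting points. So two
  coalescing cocycles are always ordered, in one direction or the other
  (\<open>dominated_total\<close>). The argument uses only the weights in an up-closed set of sites
  containing the starting points.

  The event that \<open>B\<close> lies below \<open>B'\<close> is shift invariant, so it has probability zero or one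
  (\<open>zero_one_law_reindex\<close>), and the order of two elements of \<open>\<K>\<^sub>c\<close> is deterministic. If
  their tilts have the same first component, the horizontal increments have equal means and
  therefore agree; the difference of the vertical increments is then invariant under the
  horizontal shift, and if it were positive one of the two families of paths would never leave its
  rows, contradicting coalescence. This gives uniqueness (\<open>unique_cocycle\<close>): a tilt is
  determined by its first component, and monotonicity in that component follows.

  For forward measurability, replace the weights outside a half-plane by independent copies. The
  half-plane is invariant under the shift along its boundary, so \<open>B(\<omega>)\<close> and \<open>B(\<omega>')\<close> are again
  ordered deterministically inside the half-plane. They have equal means, so they agree there
  (\<open>cocycle_resampling_invariant\<close>), which means that \<open>B\<close> depends only on the weights in the
  half-plane. Intersecting a vertical and a horizontal half-plane gives the quadrant
  (\<open>forward_version\<close>).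

  The process is built from forward measurable cocycles \<open>B\<^sup>k\<close> with \<open>k\<close> in a countable set \<open>D\<close> of tilts
  that contains every tilt isolated from one side and approximates all other tilts from both
  sides. The countably many \<open>B\<^sup>k\<close> are almost surely monotone in \<open>k\<close>, so their one-sided limits exist
  simultaneously at all tilts; these limits are \<open>B\<^sup>h\<^sup>-\<close> and \<open>B\<^sup>h\<^sup>+\<close>, and monotonicity gives the one-sided
  continuity. At a fixed \<open>h\<close> the means converge, which together with monotonicity identifies both
  limits with \<open>B\<^sup>h\<close> almost surely. Conversely, any process with the listed properties agrees with
  \<open>B\<^sup>k\<close> at the tilts in \<open>D\<close>, outside a single null set, and is determined at the remaining tilts by
  the limits.
\<close>

text \<open>
  Quantifiers over lattice sites are kept over pairs; splitting them into two integer
  quantifiers would hide the terms \<open>x + e1\<close> and \<open>x + e2\<close> from the rewriting below.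
\<close>

declare split_paired_All [simp del] split_paired_Ex [simp del]

section \<open>A zero-one law for infinite product measures\<close>

text \<open>
  Events depending on finitely many coordinates.
\<close>

definition cylinders :: "'a measure \<Rightarrow> ('i \<Rightarrow> 'a) set set" where
  "cylinders M = {(\<lambda>w. restrict w J) -` X \<inter> space (Pi\<^sub>M UNIV (\<lambda>_. M)) | J X.
     finite J \<and> X \<in> sets (Pi\<^sub>M J (\<lambda>_. M))}"

lemma cylinderE:
  assumes "C \<in> cylinders M"
  obtains J X where "finite J" "X \<in> sets (Pi\<^sub>M J (\<lambda>_. M))"
    "C = (\<lambda>w. restrict w J) -` X \<inter> space (Pi\<^sub>M UNIV (\<lambda>_. M))"
  using assms by (auto simp: cylinders_def)

lemma cylinder_enlarge:
  assumes "J \<subseteq> K" "X \<in> sets (Pi\<^sub>M J (\<lambda>_. M))"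
  obtains Y where "Y \<in> sets (Pi\<^sub>M K (\<lambda>_. M))"
    "(\<lambda>w. restrict w J) -` X \<inter> space (Pi\<^sub>M UNIV (\<lambda>_. M))
      = (\<lambda>w. restrict w K) -` Y \<inter> space (Pi\<^sub>M UNIV (\<lambda>_. M))"
proof
  show "(\<lambda>w. restrict w J) -` X \<inter> space (Pi\<^sub>M K (\<lambda>_. M)) \<in> sets (Pi\<^sub>M K (\<lambda>_. M))"
    using assms by (intro measurable_sets[OF measurable_restrict_subset]) auto
  show "(\<lambda>w. restrict w J) -` X \<inter> space (Pi\<^sub>M UNIV (\<lambda>_. M))
      = (\<lambda>w. restrict w K) -` ((\<lambda>w. restrict w J) -` X \<inter> space (Pi\<^sub>M K (\<lambda>_. M)))
        \<inter> space (Pi\<^sub>M UNIV (\<lambda>_. M))"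
    using assms(1) by (auto simp: space_PiM Int_absorb1 PiE_iff)
qed

lemma cylinder_sets:
  assumes "C \<in> cylinders M"
  shows "C \<in> sets (Pi\<^sub>M UNIV (\<lambda>_. M))"
proof -
  obtain J X where "finite J" and X: "X \<in> sets (Pi\<^sub>M J (\<lambda>_. M))"
    and C: "C = (\<lambda>w. restrict w J) -` X \<inter> space (Pi\<^sub>M UNIV (\<lambda>_. M))"
    by (rule cylinderE[OF assms])
  show ?thesis
    unfolding C by (rule measurable_sets[OF measurable_restrict_subset X]) simp
qed

lemma cylinder_Un:
  assumes "C \<in> cylinders M" "D \<in> cylinders M"
  shows "C \<union> D \<in> cylinders M"
proof -
  obtain J X where J: "finite J" and X: "X \<in> sets (Pi\<^sub>M J (\<lambda>_. M))"
    and C: "C = (\<lambda>w. restrict w J) -` X \<inter> space (Pi\<^sub>M UNIV (\<lambda>_. M))"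
    by (rule cylinderE[OF assms(1)])
  obtain K Y where K: "finite K" and Y: "Y \<in> sets (Pi\<^sub>M K (\<lambda>_. M))"
    and D: "D = (\<lambda>w. restrict w K) -` Y \<inter> space (Pi\<^sub>M UNIV (\<lambda>_. M))"
    by (rule cylinderE[OF assms(2)])
  obtain X' where X': "X' \<in> sets (Pi\<^sub>M (J \<union> K) (\<lambda>_. M))"
    "C = (\<lambda>w. restrict w (J \<union> K)) -` X' \<inter> space (Pi\<^sub>M UNIV (\<lambda>_. M))"
    using cylinder_enlarge[OF Un_upper1[of J K] X] unfolding C by metis
  obtain Y' where Y': "Y' \<in> sets (Pi\<^sub>M (J \<union> K) (\<lambda>_. M))"
    "D = (\<lambda>w. restrict w (J \<union> K)) -` Y' \<inter> space (Pi\<^sub>M UNIV (\<lambda>_. M))"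
    using cylinder_enlarge[OF Un_upper2[of K J] Y] unfolding D by metis
  have "C \<union> D = (\<lambda>w. restrict w (J \<union> K)) -` (X' \<union> Y') \<inter> space (Pi\<^sub>M UNIV (\<lambda>_. M))"
    by (auto simp: X'(2) Y'(2))
  moreover have "X' \<union> Y' \<in> sets (Pi\<^sub>M (J \<union> K) (\<lambda>_. M))"
    using X'(1) Y'(1) by auto
  ultimately show ?thesis using J K unfolding cylinders_def by blast
qed

lemma cylinder_Diff:
  assumes "C \<in> cylinders M"
  shows "space (Pi\<^sub>M UNIV (\<lambda>_. M)) - C \<in> cylinders M"
proof -
  obtain J X where J: "finite J" and X: "X \<in> sets (Pi\<^sub>M J (\<lambda>_. M))"
    and C: "C = (\<lambda>w. restrict w J) -` X \<inter> space (Pi\<^sub>M UNIV (\<lambda>_. M))"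
    by (rule cylinderE[OF assms(1)])
  have "space (Pi\<^sub>M UNIV (\<lambda>_. M)) - C
      = (\<lambda>w. restrict w J) -` (space (Pi\<^sub>M J (\<lambda>_. M)) - X) \<inter> space (Pi\<^sub>M UNIV (\<lambda>_. M))"
    by (auto simp: C space_PiM PiE_iff)
  moreover have "space (Pi\<^sub>M J (\<lambda>_. M)) - X \<in> sets (Pi\<^sub>M J (\<lambda>_. M))"
    using X by auto
  ultimately show ?thesis using J unfolding cylinders_def by blast
qed

lemma single_cylinder:
  assumes "A \<in> sets M"
  shows "{w \<in> space (Pi\<^sub>M UNIV (\<lambda>_. M)). w i \<in> A} \<in> cylinders M"
proof -
  have "{w \<in> space (Pi\<^sub>M UNIV (\<lambda>_. M)). w i \<in> A}
     = (\<lambda>w. restrict w {i}) -` ({v \<in> space (Pi\<^sub>M {i} (\<lambda>_. M)). v i \<in> A})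
        \<inter> space (Pi\<^sub>M UNIV (\<lambda>_. M))"
    by (auto simp: space_PiM PiE_iff)
  moreover have "{v \<in> space (Pi\<^sub>M {i} (\<lambda>_. M)). v i \<in> A} \<in> sets (Pi\<^sub>M {i} (\<lambda>_. M))"
    using assms by measurable
  ultimately show ?thesis unfolding cylinders_def by blast
qed

text \<open>
  Every event of an infinite product space is approximated in measure by cylinders.
\<close>

lemma cylinder_approximation:
  fixes A :: "('i \<Rightarrow> 'a) set"
  assumes M: "prob_space M" and A: "A \<in> sets (Pi\<^sub>M UNIV (\<lambda>_. M))" and "e > 0"
  shows "\<exists>C\<in>cylinders M. measure (Pi\<^sub>M UNIV (\<lambda>_. M)) (A - C \<union> (C - A)) < e"
proof -
  let ?W = "Pi\<^sub>M UNIV (\<lambda>_. M) :: ('i \<Rightarrow> 'a) measure"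
  interpret W: prob_space ?W by (intro prob_space_PiM M)
  let ?S = "{{f \<in> UNIV \<rightarrow>\<^sub>E space M. f i \<in> B} | i B. i \<in> UNIV \<and> B \<in> sets M}"
  have "A \<in> sigma_sets (UNIV \<rightarrow>\<^sub>E space M) ?S"
    using A unfolding sets_PiM_single by simp
  then have "A \<in> sets ?W \<and> (\<forall>e>0. \<exists>C\<in>cylinders M. W.prob (A - C \<union> (C - A)) < e)"
  proof (induction rule: sigma_sets.induct)
    case (Basic a)
    then obtain i B where B: "B \<in> sets M" and a: "a = {w \<in> space ?W. w i \<in> B}"
      by (auto simp: space_PiM)
    have "a \<in> cylinders M" unfolding a by (rule single_cylinder[OF B])
    then show ?case using cylinder_sets by (auto intro!: bexI[of _ a])
  next
    case Empty
    have "{} \<in> (cylinders M :: ('i \<Rightarrow> 'a) set set)" using single_cylinder[of "{}" M] by simp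
    then show ?case by (auto intro!: bexI[of _ "{}"])
  next
    case (Compl a)
    let ?c = "(UNIV \<rightarrow>\<^sub>E space M) - a"
    have sp: "(UNIV \<rightarrow>\<^sub>E space M) = space ?W" by (simp add: space_PiM)
    have "\<exists>C\<in>cylinders M. W.prob (?c - C \<union> (C - ?c)) < e" if "e > 0" for e
    proof -
      obtain C where C: "C \<in> cylinders M" "W.prob (a - C \<union> (C - a)) < e"
        using Compl.IH \<open>e > 0\<close> by blast
      have "?c - (space ?W - C) \<union> ((space ?W - C) - ?c) = a - C \<union> (C - a)"
        using cylinder_sets[OF C(1)] Compl sets.sets_into_space unfolding sp by blast
      then show ?thesis using cylinder_Diff[OF C(1)] C(2) by metis
    qed
    then show ?case using Compl unfolding sp by auto
  next
    case (Union a)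
    have [measurable]: "a i \<in> sets ?W" for i using Union by simp
    have fin: "\<exists>C\<in>cylinders M. W.prob ((\<Union>i<n. a i) - C \<union> (C - (\<Union>i<n. a i))) < e"
      if "e > 0" for e and n :: nat
      using that
    proof (induction n arbitrary: e)
      case 0
      have "{} \<in> (cylinders M :: ('i \<Rightarrow> 'a) set set)" using single_cylinder[of "{}" M] by simp
      then show ?case using 0 by (auto intro!: bexI[of _ "{}"])
    next
      case (Suc n)
      obtain C where C: "C \<in> cylinders M"
        "W.prob ((\<Union>i<n. a i) - C \<union> (C - (\<Union>i<n. a i))) < e / 2"
        using Suc.IH[of "e / 2"] Suc.prems by auto
      obtain D where D: "D \<in> cylinders M" "W.prob (a n - D \<union> (D - a n)) < e / 2"
        using Union Suc.prems by (meson half_gt_zero)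
      note [measurable] = cylinder_sets[OF C(1)] cylinder_sets[OF D(1)]
      have "W.prob ((\<Union>i<Suc n. a i) - (C \<union> D) \<union> (C \<union> D - (\<Union>i<Suc n. a i)))
        \<le> W.prob (((\<Union>i<n. a i) - C \<union> (C - (\<Union>i<n. a i))) \<union> (a n - D \<union> (D - a n)))"
        by (intro W.finite_measure_mono) (auto simp: lessThan_Suc)
      also have "\<dots> \<le> W.prob ((\<Union>i<n. a i) - C \<union> (C - (\<Union>i<n. a i)))
          + W.prob (a n - D \<union> (D - a n))"
        by (intro measure_Un_le) auto
      also have "\<dots> < e" using C D by simp
      finally show ?case using cylinder_Un[OF C(1) D(1)] by blast
    qed
    have "\<exists>C\<in>cylinders M. W.prob (\<Union> (range a) - C \<union> (C - \<Union> (range a))) < e" if "e > 0" for e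
    proof -
      have "(\<lambda>n. W.prob (\<Union>i<n. a i)) \<longlonglongrightarrow> W.prob (\<Union>n. \<Union>i<n. a i)"
        by (intro W.finite_Lim_measure_incseq) (auto simp: incseq_def intro: less_le_trans)
      also have "(\<Union>n. \<Union>i<n. a i) = \<Union> (range a)" by auto
      finally have "eventually (\<lambda>n. W.prob (\<Union>i<n. a i) > W.prob (\<Union> (range a)) - e / 2) sequentially"
        by (rule order_tendstoD) (use that in auto)
      then obtain n where n: "W.prob (\<Union>i<n. a i) > W.prob (\<Union> (range a)) - e / 2"
        by (auto simp: eventually_sequentially)
      have le: "W.prob (\<Union> (range a) - (\<Union>i<n. a i)) < e / 2"
        using n by (subst W.finite_measure_Diff) auto
      obtain C where C: "C \<in> cylinders M"
        "W.prob ((\<Union>i<n. a i) - C \<union> (C - (\<Union>i<n. a i))) < e / 2"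
        using fin[of "e / 2" n] \<open>e > 0\<close> by auto
      note [measurable] = cylinder_sets[OF C(1)]
      have "W.prob (\<Union> (range a) - C \<union> (C - \<Union> (range a)))
        \<le> W.prob ((\<Union> (range a) - (\<Union>i<n. a i)) \<union> ((\<Union>i<n. a i) - C \<union> (C - (\<Union>i<n. a i))))"
        by (intro W.finite_measure_mono) auto
      also have "\<dots> \<le> W.prob (\<Union> (range a) - (\<Union>i<n. a i))
          + W.prob ((\<Union>i<n. a i) - C \<union> (C - (\<Union>i<n. a i)))"
        by (intro measure_Un_le) auto
      also have "\<dots> < e" using C le by simp
      finally show ?thesis using C(1) by blast
    qed
    then show ?case by auto
  qed
  then show ?thesis using \<open>e > 0\<close> by blast
qed

lemma distr_reindex:
  fixes f :: "'j \<Rightarrow> 'i"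
  assumes "prob_space M" "inj f"
  shows "distr (Pi\<^sub>M UNIV (\<lambda>_. M)) (Pi\<^sub>M UNIV (\<lambda>_. M)) (\<lambda>w. w \<circ> f) = Pi\<^sub>M UNIV (\<lambda>_. M)"
  using distr_PiM_reindex[of "UNIV :: 'i set" "\<lambda>_. M" f UNIV] assms
  by (simp add: comp_def restrict_def)

lemma measurable_reindex [measurable]:
  "(\<lambda>w. w \<circ> f) \<in> measurable (Pi\<^sub>M UNIV (\<lambda>_. M)) (Pi\<^sub>M UNIV (\<lambda>_. M))"
  by (rule measurable_PiM_single') (auto simp: space_PiM PiE_iff)

lemma AE_reindex:
  assumes "prob_space M" "inj f" "AE v in Pi\<^sub>M UNIV (\<lambda>_. M). Q v"
  shows "AE w in Pi\<^sub>M UNIV (\<lambda>_. M). Q (w \<circ> f)"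
  by (rule AE_distrD[OF measurable_reindex]) (simp only: distr_reindex[OF assms(1,2)] assms(3))

lemma indep_var_restrict_disjoint:
  fixes J K :: "'i set"
  assumes M: "prob_space M" and "J \<inter> K = {}"
  shows "prob_space.indep_var (Pi\<^sub>M UNIV (\<lambda>_. M))
    (Pi\<^sub>M J (\<lambda>_. M)) (\<lambda>w. restrict w J) (Pi\<^sub>M K (\<lambda>_. M)) (\<lambda>w. restrict w K)"
proof -
  let ?W = "Pi\<^sub>M UNIV (\<lambda>_. M) :: ('i \<Rightarrow> 'a) measure"
  interpret W: prob_space ?W by (intro prob_space_PiM M)
  have "W.indep_vars (\<lambda>_. M) (\<lambda>i w. w i) UNIV"
  proof (subst W.indep_vars_iff_distr_eq_PiM)
    have "distr ?W M (\<lambda>w. w i) = M" for i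
      using distr_PiM_component[of UNIV "\<lambda>_. M" i] M by simp
    then show "distr ?W (Pi\<^sub>M UNIV (\<lambda>i. M)) (\<lambda>x. \<lambda>i\<in>UNIV. x i)
        = Pi\<^sub>M UNIV (\<lambda>i. distr ?W M (\<lambda>x. x i))"
      by (simp add: restrict_def)
  qed auto
  then have "W.indep_vars (\<lambda>b. Pi\<^sub>M (case_bool J K b) (\<lambda>_. M))
      (\<lambda>b w. restrict (\<lambda>i. w i) (case_bool J K b)) UNIV" (is "W.indep_vars ?M ?X UNIV")
    using \<open>J \<inter> K = {}\<close>
    by (intro W.indep_vars_restrict) (auto simp: disjoint_family_on_def split: bool.split)
  moreover have "?M = case_bool (Pi\<^sub>M J (\<lambda>_. M)) (Pi\<^sub>M K (\<lambda>_. M))"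
    "?X = case_bool (\<lambda>w. restrict w J) (\<lambda>w. restrict w K)"
    by (auto simp: fun_eq_iff split: bool.split)
  ultimately show ?thesis unfolding W.indep_var_def by (simp only:)
qed

lemma disjoint_cylinders_indep:
  fixes J K :: "'i set"
  assumes M: "prob_space M" and "J \<inter> K = {}"
    and X: "X \<in> sets (Pi\<^sub>M J (\<lambda>_. M))" and Y: "Y \<in> sets (Pi\<^sub>M K (\<lambda>_. M))"
  defines "W \<equiv> Pi\<^sub>M UNIV (\<lambda>_. M)"
  shows "measure W ((\<lambda>w. restrict w J) -` X \<inter> space W \<inter> ((\<lambda>w. restrict w K) -` Y \<inter> space W))
    = measure W ((\<lambda>w. restrict w J) -` X \<inter> space W) * measure W ((\<lambda>w. restrict w K) -` Y \<inter> space W)"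
proof -
  interpret W: prob_space W unfolding W_def by (intro prob_space_PiM M)
  note W.indep_varD[OF indep_var_restrict_disjoint[OF M \<open>J \<inter> K = {}\<close>, folded W_def] X Y]
  moreover have "(\<lambda>w. (restrict w J, restrict w K)) -` (X \<times> Y) \<inter> space W
      = (\<lambda>w. restrict w J) -` X \<inter> space W \<inter> ((\<lambda>w. restrict w K) -` Y \<inter> space W)"
    by auto
  ultimately show ?thesis by simp
qed

text \<open>
  An almost surely invariant event is independent of itself: up to an arbitrarily small error it is
  a cylinder, which is independent of its image under a reindexing that moves its finite
  base off itself.
\<close>

lemma zero_one_law_reindex:
  fixes A :: "('i \<Rightarrow> 'a) set" and \<tau> :: "nat \<Rightarrow> 'i \<Rightarrow> 'i"
  assumes M: "prob_space M" and A: "A \<in> sets (Pi\<^sub>M UNIV (\<lambda>_. M))"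
    and inj: "\<And>n. inj (\<tau> n)"
    and leave: "\<And>J. finite J \<Longrightarrow> \<exists>n. \<tau> n ` J \<inter> J = {}"
    and inv: "\<And>n. AE w in Pi\<^sub>M UNIV (\<lambda>_. M). w \<in> A \<longleftrightarrow> w \<circ> \<tau> n \<in> A"
  shows "measure (Pi\<^sub>M UNIV (\<lambda>_. M)) A = 0 \<or> measure (Pi\<^sub>M UNIV (\<lambda>_. M)) A = 1"
proof -
  let ?W = "Pi\<^sub>M UNIV (\<lambda>_. M) :: ('i \<Rightarrow> 'a) measure"
  interpret W: prob_space ?W by (intro prob_space_PiM M)
  note [measurable] = A
  have "\<bar>W.prob A - W.prob A * W.prob A\<bar> \<le> e" if "e > 0" for e
  proof -
    obtain C where C: "C \<in> cylinders M" and CA: "W.prob (A - C \<union> (C - A)) < e / 4"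
      using cylinder_approximation[OF M A, of "e / 4"] \<open>e > 0\<close> by auto
    note [measurable] = cylinder_sets[OF C]
    obtain J X where J: "finite J" and X: "X \<in> sets (Pi\<^sub>M J (\<lambda>_. M))"
      and CX: "C = (\<lambda>w. restrict w J) -` X \<inter> space ?W"
      by (rule cylinderE[OF C])
    obtain n where n: "\<tau> n ` J \<inter> J = {}" using leave[OF J] by auto
    let ?T = "\<lambda>w. w \<circ> \<tau> n"
    let ?t = "\<lambda>B. ?T -` B \<inter> space ?W"
    have pres: "W.prob (?t B) = W.prob B" if "B \<in> sets ?W" for B
      using measure_distr[OF measurable_reindex that, of "\<tau> n"] distr_reindex[OF M inj[of n]] by simp
    define Y where "Y = (\<lambda>v. restrict (v \<circ> \<tau> n) J) -` X \<inter> space (Pi\<^sub>M (\<tau> n ` J) (\<lambda>_. M))"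
    have "(\<lambda>v. restrict (v \<circ> \<tau> n) J) \<in> measurable (Pi\<^sub>M (\<tau> n ` J) (\<lambda>_. M)) (Pi\<^sub>M J (\<lambda>_. M))"
      by (rule measurable_restrict) auto
    from measurable_sets[OF this X] have Y: "Y \<in> sets (Pi\<^sub>M (\<tau> n ` J) (\<lambda>_. M))"
      by (simp add: Y_def)
    have rr: "restrict (restrict w (\<tau> n ` J) \<circ> \<tau> n) J = restrict (w \<circ> \<tau> n) J" for w :: "'i \<Rightarrow> 'a"
      by (auto simp: fun_eq_iff)
    have tC: "?t C = (\<lambda>w. restrict w (\<tau> n ` J)) -` Y \<inter> space ?W"
      unfolding CX Y_def by (auto simp: space_PiM PiE_iff rr)
    have ind: "W.prob (C \<inter> ?t C) = W.prob C * W.prob C"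
      using disjoint_cylinders_indep[OF M _ X Y] n pres[of C] unfolding tC[symmetric] CX[symmetric]
      by (simp add: Int_commute)
    have AtA: "W.prob (A \<inter> ?t A) = W.prob A"
      using inv[of n] by (intro W.finite_measure_eq_AE) auto
    have tt: "W.prob (?t (A - C \<union> (C - A))) < e / 4"
      using pres[of "A - C \<union> (C - A)"] CA by simp
    have [measurable]: "?t B \<in> sets ?W" if "B \<in> sets ?W" for B
      using that by measurable
    have 1: "\<bar>W.prob A - W.prob C\<bar> \<le> e / 4"
    proof -
      have "W.prob A \<le> W.prob (C \<union> (A - C \<union> (C - A)))" by (intro W.finite_measure_mono) auto
      also have "\<dots> \<le> W.prob C + W.prob (A - C \<union> (C - A))"
        by (intro measure_Un_le) auto
      finally have "W.prob A \<le> W.prob C + e / 4" using CA by simp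
      moreover have "W.prob C \<le> W.prob (A \<union> (A - C \<union> (C - A)))"
        by (intro W.finite_measure_mono) auto
      moreover have "\<dots> \<le> W.prob A + W.prob (A - C \<union> (C - A))"
        by (intro measure_Un_le) auto
      ultimately show ?thesis using CA by linarith
    qed
    have 2: "\<bar>W.prob (A \<inter> ?t A) - W.prob (C \<inter> ?t C)\<bar> \<le> e / 2"
    proof -
      let ?D = "(A - C \<union> (C - A)) \<union> ?t (A - C \<union> (C - A))"
      have D: "W.prob ?D \<le> e / 2"
        using measure_Un_le[of "A - C \<union> (C - A)" ?W "?t (A - C \<union> (C - A))"] CA tt by simp
      have "W.prob (A \<inter> ?t A) \<le> W.prob ((C \<inter> ?t C) \<union> ?D)" by (intro W.finite_measure_mono) auto
      also have "\<dots> \<le> W.prob (C \<inter> ?t C) + W.prob ?D"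
        by (intro measure_Un_le) auto
      finally have a: "W.prob (A \<inter> ?t A) \<le> W.prob (C \<inter> ?t C) + W.prob ?D" .
      have "W.prob (C \<inter> ?t C) \<le> W.prob ((A \<inter> ?t A) \<union> ?D)" by (intro W.finite_measure_mono) auto
      also have "\<dots> \<le> W.prob (A \<inter> ?t A) + W.prob ?D"
        by (intro measure_Un_le) auto
      finally show ?thesis using a D by linarith
    qed
    have "\<bar>W.prob A * W.prob A - W.prob C * W.prob C\<bar> = \<bar>W.prob A - W.prob C\<bar> * (W.prob A + W.prob C)"
      by (simp add: square_diff_square_factored abs_mult mult.commute)
    also have "\<dots> \<le> e / 4 * 2" using 1 \<open>e > 0\<close> add_mono[OF W.prob_le_1[of A] W.prob_le_1[of C]]
      by (intro mult_mono) auto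
    finally have 3: "\<bar>W.prob A * W.prob A - W.prob C * W.prob C\<bar> \<le> e / 2" by simp
    show ?thesis using 2 3 unfolding ind AtA by linarith
  qed
  then have "W.prob A - W.prob A * W.prob A = 0"
    using field_le_epsilon[of "\<bar>W.prob A - W.prob A * W.prob A\<bar>" 0] by simp
  then have "W.prob A * (1 - W.prob A) = 0" by (simp add: algebra_simps)
  then show ?thesis by simp
qed

section \<open>Comparison of coalescing cocycles\<close>

text \<open>
  Sets of sites that are closed under up-right steps, and hence contain every up-right path that
  starts in them.
\<close>

definition up_closed :: "site set \<Rightarrow> bool" where
  "up_closed S \<longleftrightarrow> (\<forall>x\<in>S. x + e1 \<in> S \<and> x + e2 \<in> S)"

text \<open>
  The order on cocycles that is induced by comparing increments on \<open>S\<close>: moving \<open>b\<close> down in this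
  order corresponds to paths further to the right. It is a preorder on the increments inside \<open>S\<close>
  only.
\<close>

definition dominated :: "site set \<Rightarrow> (site \<Rightarrow> site \<Rightarrow> real) \<Rightarrow> (site \<Rightarrow> site \<Rightarrow> real) \<Rightarrow> bool" where
  "dominated S b b' \<longleftrightarrow>
     (\<forall>x\<in>S. b x (x + e1) \<le> b' x (x + e1) \<and> b' x (x + e2) \<le> b x (x + e2))"

lemma cocycle_add: "cocycle b \<Longrightarrow> b x y + b y z = b x z"
  unfolding cocycle_def by blast

lemma cocycle_diff: "cocycle b \<Longrightarrow> b x y = b x z - b y z"
  using cocycle_add[of b x y z] by simp

lemma cocycle_self [simp]: "cocycle b \<Longrightarrow> b x x = 0"
  using cocycle_add[of b x x x] by simp

lemma recovers_le:
  assumes "recovers b \<omega>"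
  shows "\<omega> x \<le> b x (x + e1)" "\<omega> x \<le> b x (x + e2)"
  using assms unfolding recovers_def by (metis min.cobounded1, metis min.cobounded2)

lemma level_walk: "level (walk b u n) = level u + int n"
  by (induction n) (auto simp: level_def Let_def)

lemma walk_in: "up_closed S \<Longrightarrow> u \<in> S \<Longrightarrow> walk b u n \<in> S"
  by (induction n) (auto simp: up_closed_def Let_def)

lemma walk_Suc_cases:
  obtains "walk b u (Suc n) = walk b u n + e1" | "walk b u (Suc n) = walk b u n + e2"
  by (cases "b (walk b u n) (walk b u n + e1) \<le> b (walk b u n) (walk b u n + e2)") (auto simp: Let_def)

lemma walk_step_weight:
  assumes "recovers b \<omega>"
  shows "b (walk b u n) (walk b u (Suc n)) = \<omega> (walk b u n)"
proof -
  have "min (b (walk b u n) (walk b u n + e1)) (b (walk b u n) (walk b u n + e2)) = \<omega> (walk b u n)"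
    using assms unfolding recovers_def by blast
  then show ?thesis by (auto simp: Let_def min_def split: if_splits)
qed

text \<open>
  A cocycle recovering the weights is minimal along its own paths: there it equals the sum of the
  weights, which bounds any other such cocycle from below.
\<close>

lemma cocycle_le_along_walk:
  assumes b: "cocycle b" "recovers b \<omega>" and b': "cocycle b'" "recovers b' \<omega>'"
    and S: "up_closed S" "\<And>y. y \<in> S \<Longrightarrow> \<omega> y = \<omega>' y" "x \<in> S"
  shows "b x (walk b x n) \<le> b' x (walk b x n)"
proof (induction n)
  case 0
  then show ?case using b b' by simp
next
  case (Suc n)
  let ?y = "walk b x n" and ?z = "walk b x (Suc n)"
  have "b ?y ?z = \<omega>' ?y"
    using walk_step_weight[OF b(2)] S walk_in[OF S(1,3)] by metis
  also have "\<dots> \<le> b' ?y ?z"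
    using recovers_le[OF b'(2), of ?y] by (cases rule: walk_Suc_cases[of b x n]) simp_all
  finally show ?case
    using Suc cocycle_add[OF b(1), of x ?y ?z] cocycle_add[OF b'(1), of x ?y ?z] by linarith
qed

lemma site_eqI: "fst x = fst y \<Longrightarrow> level x = level y \<Longrightarrow> x = (y :: site)"
  by (auto simp: level_def prod_eq_iff)

text \<open>
  Discrete intermediate value theorem: the horizontal distance of two up-right paths changes by at
  most one per level.
\<close>

lemma walks_meet:
  assumes "level u = level v" "fst u \<le> fst v" "fst (walk b' v n) \<le> fst (walk b u n)"
  obtains m where "walk b u m = walk b' v m"
proof -
  define d where "d i = fst (walk b u i) - fst (walk b' v i)" for i
  have "\<bar>d (i + 1) - d i\<bar> \<le> 1" for i
    unfolding d_def
    by (cases rule: walk_Suc_cases[of b u i]; cases rule: walk_Suc_cases[of b' v i]) simp_all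
  then obtain m where "d m = 0"
    using nat0_intermed_int_val[of n d 0] assms by (auto simp: d_def)
  then have "walk b u m = walk b' v m"
    using assms(1) by (intro site_eqI) (auto simp: d_def level_walk)
  then show ?thesis by (rule that)
qed

lemma walk_Suc_eq: "walk b u (Suc n) = walk b (walk b u 1) n"
  by (induction n) (auto simp: Let_def)

text \<open>
  One level above \<open>x\<close> the \<open>b\<close>-path from \<open>x\<close> is weakly to the left of \<open>x + e1\<close>; if it is later weakly to
  the right of the \<open>b'\<close>-path from \<open>x + e1\<close>, the two paths meet.
\<close>

lemma right_increment_le:
  assumes b: "cocycle b" "recovers b \<omega>" and b': "cocycle b'" "recovers b' \<omega>'"
    and S: "up_closed S" "\<And>y. y \<in> S \<Longrightarrow> \<omega> y = \<omega>' y" "x \<in> S"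
    and n: "fst (walk b' (x + e1) n) \<le> fst (walk b x (Suc n))"
  shows "b x (x + e1) \<le> b' x (x + e1)"
proof -
  have "fst (walk b x 1) \<le> fst (x + e1)" "level (walk b x 1) = level (x + e1)"
    by (auto simp: Let_def level_def)
  then obtain m where m: "walk b (walk b x 1) m = walk b' (x + e1) m"
    using walks_meet[of "walk b x 1" "x + e1" b' n b] n by (auto simp only: walk_Suc_eq[of b x])
  define p where "p = walk b x (Suc m)"
  have p': "p = walk b' (x + e1) m" using m unfolding p_def walk_Suc_eq[of b x] by simp
  have "b x p \<le> b' x p"
    unfolding p_def by (rule cocycle_le_along_walk[OF b b' S])
  moreover have "b' (x + e1) p \<le> b (x + e1) p"
    unfolding p' using S
    by (intro cocycle_le_along_walk[OF b' b S(1)]) (auto simp: up_closed_def)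
  ultimately show ?thesis
    using cocycle_diff[OF b(1), of x "x + e1" p] cocycle_diff[OF b'(1), of x "x + e1" p] by linarith
qed

lemma up_increment_le:
  assumes b: "cocycle b" "recovers b \<omega>" and b': "cocycle b'" "recovers b' \<omega>'"
    and S: "up_closed S" "\<And>y. y \<in> S \<Longrightarrow> \<omega> y = \<omega>' y" "x \<in> S"
    and n: "fst (walk b' x (Suc n)) \<le> fst (walk b (x + e2) n)"
  shows "b' x (x + e2) \<le> b x (x + e2)"
proof -
  have "fst (x + e2) \<le> fst (walk b' x 1)" "level (x + e2) = level (walk b' x 1)"
    by (auto simp: Let_def level_def)
  then obtain m where m: "walk b (x + e2) m = walk b' (walk b' x 1) m"
    using walks_meet[of "x + e2" "walk b' x 1" b' n b] n by (auto simp only: walk_Suc_eq[of b' x])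
  define p where "p = walk b' x (Suc m)"
  have p': "p = walk b (x + e2) m" using m unfolding p_def walk_Suc_eq[of b' x] by simp
  have "b' x p \<le> b x p"
    unfolding p_def using S by (intro cocycle_le_along_walk[OF b' b S(1)]) auto
  moreover have "b (x + e2) p \<le> b' (x + e2) p"
    unfolding p' using S
    by (intro cocycle_le_along_walk[OF b b' S(1)]) (auto simp: up_closed_def)
  ultimately show ?thesis
    using cocycle_diff[OF b(1), of x "x + e2" p] cocycle_diff[OF b'(1), of x "x + e2" p] by linarith
qed

text \<open>
  By coalescence, a comparison of the two paths from the origin at arbitrarily large levels
  transfers to any pair of starting points.
\<close>

lemma dominated_if_right:
  assumes b: "cocycle b" "recovers b \<omega>" and b': "cocycle b'" "recovers b' \<omega>'"
    and S: "up_closed S" "\<And>y. y \<in> S \<Longrightarrow> \<omega> y = \<omega>' y"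
    and co: "\<And>u v. coalesce (level_path b u) (level_path b v)"
    and co': "\<And>u v. coalesce (level_path b' u) (level_path b' v)"
    and right: "\<And>N. \<exists>i\<ge>N. fst (level_path b' 0 i) \<le> fst (level_path b 0 i)"
  shows "dominated S b b'"
proof -
  have far: "\<exists>i\<ge>N. fst (level_path b' v i) \<le> fst (level_path b u i)" for u v N
  proof -
    obtain K where K: "\<And>i. K \<le> i \<Longrightarrow> level_path b u i = level_path b 0 i"
      using co[of u 0] by (auto simp: coalesce_def)
    obtain L where L: "\<And>i. L \<le> i \<Longrightarrow> level_path b' v i = level_path b' 0 i"
      using co'[of v 0] by (auto simp: coalesce_def)
    obtain i where "i \<ge> max N (max K L)" "fst (level_path b' 0 i) \<le> fst (level_path b 0 i)"
      using right by blast
    then show ?thesis using K[of i] L[of i] by (intro exI[of _ i]) auto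
  qed
  show ?thesis unfolding dominated_def
  proof (intro ballI conjI)
    fix x assume x: "x \<in> S"
    obtain i where i: "i \<ge> level x + 1" "fst (level_path b' (x + e1) i) \<le> fst (level_path b x i)"
      using far by blast
    define n where "n = nat (i - level x - 1)"
    have "nat (i - level x) = Suc n" "nat (i - level (x + e1)) = n"
      using i(1) by (auto simp: n_def level_def)
    then show "b x (x + e1) \<le> b' x (x + e1)"
      using i(2) right_increment_le[OF b b' S x, of n] by (simp only: level_path_def)
    obtain i where i: "i \<ge> level x + 1" "fst (level_path b' x i) \<le> fst (level_path b (x + e2) i)"
      using far by blast
    define n where "n = nat (i - level x - 1)"
    have "nat (i - level x) = Suc n" "nat (i - level (x + e2)) = n"
      using i(1) by (auto simp: n_def level_def)
    then show "b' x (x + e2) \<le> b x (x + e2)"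
      using i(2) up_increment_le[OF b b' S x, of n] by (simp only: level_path_def)
  qed
qed

lemma dominated_total:
  assumes b: "cocycle b" "recovers b \<omega>" and b': "cocycle b'" "recovers b' \<omega>'"
    and S: "up_closed S" "\<And>y. y \<in> S \<Longrightarrow> \<omega> y = \<omega>' y"
    and co: "\<And>u v. coalesce (level_path b u) (level_path b v)"
    and co': "\<And>u v. coalesce (level_path b' u) (level_path b' v)"
  shows "dominated S b b' \<or> dominated S b' b"
proof (cases "\<forall>N. \<exists>i\<ge>N. fst (level_path b' 0 i) \<le> fst (level_path b 0 i)")
  case True
  then show ?thesis using dominated_if_right[OF b b' S co co'] by blast
next
  case False
  then obtain N where N: "\<And>i. i \<ge> N \<Longrightarrow> fst (level_path b 0 i) \<le> fst (level_path b' 0 i)"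
    by (meson linear)
  have "\<exists>i\<ge>M. fst (level_path b 0 i) \<le> fst (level_path b' 0 i)" for M
    using N[of "max M N"] by (intro exI[of _ "max M N"]) auto
  then have "dominated S b' b"
    using S by (intro dominated_if_right[OF b' b S(1) _ co' co]) auto
  then show ?thesis ..
qed

text \<open>
  A relation that holds on the edges in an up-closed set and is compatible with composition and
  with going backwards along a common endpoint holds throughout the set: \<open>x\<close> and \<open>y\<close> both lead, by
  up-right steps, to their coordinatewise maximum.
\<close>

lemma lattice_path_induct:
  assumes S: "up_closed S" and x: "x \<in> S" and y: "y \<in> S"
    and refl: "\<And>x. x \<in> S \<Longrightarrow> R x x"
    and edge1: "\<And>x. x \<in> S \<Longrightarrow> R x (x + e1)" and edge2: "\<And>x. x \<in> S \<Longrightarrow> R x (x + e2)"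
    and trans: "\<And>x y z. R x y \<Longrightarrow> R y z \<Longrightarrow> R x z"
    and join: "\<And>x y z. R x z \<Longrightarrow> R y z \<Longrightarrow> R x y"
  shows "R x y"
proof -
  have right: "R u (u + (int m, 0)) \<and> u + (int m, 0) \<in> S" if "u \<in> S" for u m
  proof (induction m)
    case 0
    then show ?case using refl[OF that] that by (simp add: zero_prod_def[symmetric])
  next
    case (Suc m)
    have "u + (int (Suc m), 0) = u + (int m, 0) + e1" by (simp add: prod_eq_iff)
    then show ?case
      using trans[OF conjunct1[OF Suc] edge1[OF conjunct2[OF Suc]]] conjunct2[OF Suc] S
      by (simp only: up_closed_def)
  qed
  have up: "R u (u + (0, int n)) \<and> u + (0, int n) \<in> S" if "u \<in> S" for u n
  proof (induction n)
    case 0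
    then show ?case using refl[OF that] that by (simp add: zero_prod_def[symmetric])
  next
    case (Suc n)
    have "u + (0, int (Suc n)) = u + (0, int n) + e2" by (simp add: prod_eq_iff)
    then show ?case
      using trans[OF conjunct1[OF Suc] edge2[OF conjunct2[OF Suc]]] conjunct2[OF Suc] S
      by (simp only: up_closed_def)
  qed
  define z where "z = (max (fst x) (fst y), max (snd x) (snd y))"
  have "R u z" if "u \<in> S" "fst u \<le> fst z" "snd u \<le> snd z" for u
  proof -
    have z: "z = u + (int (nat (fst z - fst u)), 0) + (0, int (nat (snd z - snd u)))"
      using that by (simp add: prod_eq_iff)
    show ?thesis
      using trans[OF conjunct1[OF right] conjunct1[OF up], of u] right that(1) z by metis
  qed
  then show ?thesis using x y by (intro join[of x z y]) (auto simp: z_def)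
qed

lemma edges_tendsto:
  fixes b :: "'k \<Rightarrow> site \<Rightarrow> site \<Rightarrow> real"
  assumes coc: "eventually (\<lambda>k. cocycle (b k)) F" and c: "cocycle c"
    and e: "\<And>x. ((\<lambda>k. b k x (x + e1)) \<longlongrightarrow> c x (x + e1)) F"
      "\<And>x. ((\<lambda>k. b k x (x + e2)) \<longlongrightarrow> c x (x + e2)) F"
  shows "((\<lambda>k. b k x y) \<longlongrightarrow> c x y) F"
proof (rule lattice_path_induct[of UNIV x y])
  show "((\<lambda>k. b k x x) \<longlongrightarrow> c x x) F" for x
    by (rule Lim_transform_eventually[OF tendsto_const])
       (rule eventually_mono[OF coc], simp add: c)
  fix x y z
  show "((\<lambda>k. b k x z) \<longlongrightarrow> c x z) F"
    if "((\<lambda>k. b k x y) \<longlongrightarrow> c x y) F" "((\<lambda>k. b k y z) \<longlongrightarrow> c y z) F"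
  proof (rule Lim_transform_eventually)
    show "((\<lambda>k. b k x y + b k y z) \<longlongrightarrow> c x z) F"
      using tendsto_add[OF that] by (simp add: cocycle_add[OF c])
    show "eventually (\<lambda>k. b k x y + b k y z = b k x z) F"
      using coc by eventually_elim (rule cocycle_add)
  qed
  show "((\<lambda>k. b k x y) \<longlongrightarrow> c x y) F"
    if "((\<lambda>k. b k x z) \<longlongrightarrow> c x z) F" "((\<lambda>k. b k y z) \<longlongrightarrow> c y z) F"
  proof (rule Lim_transform_eventually)
    show "((\<lambda>k. b k x z - b k y z) \<longlongrightarrow> c x y) F"
      using tendsto_diff[OF that] by (simp add: cocycle_diff[OF c, of x y z])
    show "eventually (\<lambda>k. b k x z - b k y z = b k x y) F"
      by (rule eventually_mono[OF coc], rule cocycle_diff[symmetric])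
  qed
qed (use e in \<open>auto simp: up_closed_def\<close>)

lemma edges_convergent:
  fixes b :: "'k \<Rightarrow> site \<Rightarrow> site \<Rightarrow> real"
  assumes coc: "eventually (\<lambda>k. cocycle (b k)) F" and F: "F \<noteq> bot"
    and e: "\<And>x. \<exists>l. ((\<lambda>k. b k x (x + e1)) \<longlongrightarrow> l) F"
      "\<And>x. \<exists>l. ((\<lambda>k. b k x (x + e2)) \<longlongrightarrow> l) F"
  obtains c where "cocycle c" "\<And>x y. ((\<lambda>k. b k x y) \<longlongrightarrow> c x y) F"
proof -
  have "\<exists>l. ((\<lambda>k. b k x y) \<longlongrightarrow> l) F" for x y
  proof (rule lattice_path_induct[of UNIV x y])
    show "\<exists>l. ((\<lambda>k. b k x x) \<longlongrightarrow> l) F" for x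
      by (rule exI[of _ 0], rule Lim_transform_eventually[OF tendsto_const])
         (rule eventually_mono[OF coc], simp)
    fix x y z
    show "\<exists>l. ((\<lambda>k. b k x z) \<longlongrightarrow> l) F"
      if ex: "\<exists>l. ((\<lambda>k. b k x y) \<longlongrightarrow> l) F" "\<exists>l. ((\<lambda>k. b k y z) \<longlongrightarrow> l) F"
    proof -
      obtain l l' where l: "((\<lambda>k. b k x y) \<longlongrightarrow> l) F" "((\<lambda>k. b k y z) \<longlongrightarrow> l') F"
        using ex by blast
      have "eventually (\<lambda>k. b k x y + b k y z = b k x z) F"
        using coc by eventually_elim (rule cocycle_add)
      from Lim_transform_eventually[OF tendsto_add[OF l] this] show ?thesis ..
    qed
    show "\<exists>l. ((\<lambda>k. b k x y) \<longlongrightarrow> l) F"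
      if ex: "\<exists>l. ((\<lambda>k. b k x z) \<longlongrightarrow> l) F" "\<exists>l. ((\<lambda>k. b k y z) \<longlongrightarrow> l) F"
    proof -
      obtain l l' where l: "((\<lambda>k. b k x z) \<longlongrightarrow> l) F" "((\<lambda>k. b k y z) \<longlongrightarrow> l') F"
        using ex by blast
      have "eventually (\<lambda>k. b k x z - b k y z = b k x y) F"
        by (rule eventually_mono[OF coc], rule cocycle_diff[symmetric])
      from Lim_transform_eventually[OF tendsto_diff[OF l] this] show ?thesis ..
    qed
  qed (use e in \<open>auto simp: up_closed_def\<close>)
  then obtain c where c: "\<And>x y. ((\<lambda>k. b k x y) \<longlongrightarrow> c x y) F" by metis
  have "c x y + c y z = c x z" for x y z
  proof (rule tendsto_unique[OF F])
    show "((\<lambda>k. b k x y + b k y z) \<longlongrightarrow> c x y + c y z) F" by (intro tendsto_add c)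
    have "eventually (\<lambda>k. b k x z = b k x y + b k y z) F"
      by (rule eventually_mono[OF coc], rule cocycle_add[symmetric])
    then show "((\<lambda>k. b k x y + b k y z) \<longlongrightarrow> c x z) F"
      by (rule Lim_transform_eventually[OF c])
  qed
  then have "cocycle c" unfolding cocycle_def by blast
  then show ?thesis using c by (rule that)
qed

lemma cocycle_eqI:
  assumes S: "up_closed S" and b: "cocycle b" and c: "cocycle c"
    and e: "\<And>x. x \<in> S \<Longrightarrow> b x (x + e1) = c x (x + e1)"
      "\<And>x. x \<in> S \<Longrightarrow> b x (x + e2) = c x (x + e2)"
    and x: "x \<in> S" and y: "y \<in> S"
  shows "b x y = c x y"
proof (rule lattice_path_induct[OF S x y])
  fix x y z
  show "b x z = c x z" if "b x y = c x y" "b y z = c y z"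
    using that cocycle_add[OF b, of x y z] cocycle_add[OF c, of x y z] by linarith
  show "b x y = c x y" if "b x z = c x z" "b y z = c y z"
    using that cocycle_diff[OF b, of x y z] cocycle_diff[OF c, of x y z] by linarith
qed (simp_all add: b c e)

section \<open>Uniqueness and monotonicity in the tilt\<close>

text \<open>
  The abbreviation \<open>W\<close> stands for the law of two independent environments: the weight of the first
  one at \<open>x\<close> is the coordinate \<open>(x, True)\<close>, that of the second one is \<open>(x, False)\<close>.
\<close>

locale iid_environment =
  fixes \<mu> :: "real measure"
  assumes prob_\<mu>: "prob_space \<mu>" and sets_\<mu>: "sets \<mu> = sets borel"
begin

abbreviation P :: "env measure" where "P \<equiv> Pi\<^sub>M UNIV (\<lambda>_. \<mu>)"

abbreviation W :: "(site \<times> bool \<Rightarrow> real) measure" where "W \<equiv> Pi\<^sub>M UNIV (\<lambda>_. \<mu>)"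

text \<open>
  The first environment, and the environment obtained from it by replacing the weights outside \<open>I\<close>
  by those of the second. Both have law \<open>P\<close> under \<open>W\<close>.
\<close>

definition primary :: "(site \<times> bool \<Rightarrow> real) \<Rightarrow> env" where
  "primary w = w \<circ> (\<lambda>x. (x, True))"

definition resampled :: "site set \<Rightarrow> (site \<times> bool \<Rightarrow> real) \<Rightarrow> env" where
  "resampled I w = w \<circ> (\<lambda>x. (x, x \<in> I))"

sublocale P: prob_space P by (intro prob_space_PiM prob_\<mu>)
sublocale W: prob_space W by (intro prob_space_PiM prob_\<mu>)

lemma shift_eq_reindex: "shift z = (\<lambda>\<omega>. \<omega> \<circ> (\<lambda>x. x + z))"
  by (simp add: Defs.shift_def fun_eq_iff)

lemma measurable_shift [measurable]: "shift z \<in> measurable P P"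
  unfolding shift_eq_reindex by measurable

lemma distr_shift: "distr P P (shift z) = P"
  unfolding shift_eq_reindex by (rule distr_reindex[OF prob_\<mu>]) (auto simp: inj_def)

lemma AE_shift: "AE \<omega> in P. Q \<omega> \<Longrightarrow> AE \<omega> in P. Q (shift z \<omega>)"
  unfolding shift_eq_reindex by (rule AE_reindex[OF prob_\<mu>]) (auto simp: inj_def)

lemma measurable_primary [measurable]: "primary \<in> measurable W P"
  unfolding primary_def by measurable

lemma measurable_resampled [measurable]: "resampled I \<in> measurable W P"
  unfolding resampled_def by measurable

lemma distr_primary: "distr W P primary = P"
  unfolding primary_def by (rule distr_reindex[OF prob_\<mu>]) (auto simp: inj_def)

lemma distr_resampled: "distr W P (resampled I) = P"
  unfolding resampled_def by (rule distr_reindex[OF prob_\<mu>]) (auto simp: inj_def)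

lemma AE_primary: "AE \<omega> in P. Q \<omega> \<Longrightarrow> AE w in W. Q (primary w)"
  unfolding primary_def by (rule AE_reindex[OF prob_\<mu>]) (auto simp: inj_def)

lemma AE_resampled: "AE \<omega> in P. Q \<omega> \<Longrightarrow> AE w in W. Q (resampled I w)"
  unfolding resampled_def by (rule AE_reindex[OF prob_\<mu>]) (auto simp: inj_def)

lemma resampled_UNIV: "resampled UNIV = primary"
  by (auto simp: resampled_def primary_def)

lemma class_measurable:
  assumes "B \<in> cocycle_class P"
  shows "(\<lambda>\<omega>. B \<omega> x y) \<in> borel_measurable P"
proof -
  have B: "(\<lambda>(\<omega>, x, y). B \<omega> x y) \<in> borel_measurable (P \<Otimes>\<^sub>M count_space UNIV)"
    using assms by (simp add: cocycle_class_def)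
  have "(\<lambda>\<omega>. (\<omega>, x, y)) \<in> measurable P (P \<Otimes>\<^sub>M count_space UNIV)" by measurable
  from measurable_compose[OF this B] show ?thesis by simp
qed

lemma class_joint_measurable:
  assumes "\<And>x y. (\<lambda>\<omega>. B \<omega> x y) \<in> borel_measurable P"
  shows "(\<lambda>(\<omega>, x, y). B \<omega> x y) \<in> borel_measurable (P \<Otimes>\<^sub>M count_space (UNIV :: (site \<times> site) set))"
proof -
  have "(\<lambda>p. (\<lambda>q \<omega>. B \<omega> (fst q) (snd q)) (snd p) (fst p)) \<in> borel_measurable
      (P \<Otimes>\<^sub>M count_space (UNIV :: (site \<times> site) set))"
    by (rule measurable_compose_countable[where g=snd])
       (auto intro: measurable_compose[OF measurable_fst assms])
  then show ?thesis by (simp add: case_prod_beta')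
qed

lemma coalescing_in_class: "B \<in> coalescing_class P \<Longrightarrow> B \<in> cocycle_class P"
  by (simp add: coalescing_class_def)

lemma class_AE:
  assumes "B \<in> cocycle_class P"
  shows "AE \<omega> in P. cocycle (B \<omega>)" "AE \<omega> in P. recovers (B \<omega>) \<omega>"
    "AE \<omega> in P. \<forall>x y z. B \<omega> (x + z) (y + z) = B (shift z \<omega>) x y"
  using assms by (auto simp: cocycle_class_def)

lemma coalescing_AE:
  assumes "B \<in> coalescing_class P"
  shows "AE \<omega> in P. \<forall>u v. coalesce (level_path (B \<omega>) u) (level_path (B \<omega>) v)"
  using assms by (simp add: coalescing_class_def)

lemma class_integrable: "B \<in> cocycle_class P \<Longrightarrow> integrable P (\<lambda>\<omega>. B \<omega> x y)"
  by (simp add: cocycle_class_def)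

lemma stationary_integral:
  assumes B: "B \<in> cocycle_class P"
  shows "(\<integral>\<omega>. B \<omega> (x + z) (y + z) \<partial>P) = (\<integral>\<omega>. B \<omega> x y \<partial>P)"
proof -
  note [measurable] = class_measurable[OF B]
  have "(\<integral>\<omega>. B \<omega> x y \<partial>P) = (\<integral>\<omega>. B \<omega> x y \<partial>distr P P (shift z))" by (simp only: distr_shift)
  also have "\<dots> = (\<integral>\<omega>. B (shift z \<omega>) x y \<partial>P)" by (rule integral_distr) measurable
  also have "\<dots> = (\<integral>\<omega>. B \<omega> (x + z) (y + z) \<partial>P)"
    using class_AE(3)[OF B] by (intro integral_cong_AE) auto
  finally show ?thesis ..
qed

lemma edge_integral:
  assumes B: "B \<in> cocycle_class P"
  shows "(\<integral>\<omega>. B \<omega> x (x + e1) \<partial>P) = - (tilt P B \<bullet> e1)"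
    "(\<integral>\<omega>. B \<omega> x (x + e2) \<partial>P) = - (tilt P B \<bullet> e2)"
  using stationary_integral[OF B, of 0 x e1] stationary_integral[OF B, of 0 x e2]
  by (simp_all add: tilt_def inner_prod_def add.commute)

lemma dominated_measurable:
  assumes [measurable]: "\<And>x y. (\<lambda>\<omega>. B \<omega> x y) \<in> borel_measurable P"
      "\<And>x y. (\<lambda>\<omega>. B' \<omega> x y) \<in> borel_measurable P"
    and [measurable]: "f \<in> measurable N P" "f' \<in> measurable N P"
  shows "{w \<in> space N. dominated S (B (f w)) (B' (f' w))} \<in> sets N"
  unfolding dominated_def by measurable

text \<open>
  The order of \<open>B\<close> and \<open>B'\<close> inside \<open>I\<close> is deterministic even if \<open>B'\<close> sees weights that have been
  resampled outside \<open>I\<close>, provided \<open>I\<close> is invariant under some shift \<open>z\<close> with \<open>level z = 1\<close>, whose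
  iterates move every finite set of sites off itself. For
  \<open>I = UNIV\<close> both cocycles see the same environment.
\<close>

lemma comparison:
  assumes B: "B \<in> coalescing_class P" and B': "B' \<in> coalescing_class P"
    and up: "up_closed I" and z: "level z = 1" and I: "\<And>x. x + z \<in> I \<longleftrightarrow> x \<in> I"
  shows "(AE w in W. dominated I (B (primary w)) (B' (resampled I w))) \<or>
         (AE w in W. dominated I (B' (resampled I w)) (B (primary w)))"
proof -
  note K = coalescing_in_class[OF B] and K' = coalescing_in_class[OF B']
  note [measurable] = class_measurable[OF K] class_measurable[OF K']
  define A where "A = {w \<in> space W. dominated I (B (primary w)) (B' (resampled I w))}"
  have A: "A \<in> sets W" unfolding A_def by (rule dominated_measurable) measurable
  define zn where "zn n = (int n * fst z, int n * snd z)" for n :: nat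
  have zn_I: "x + zn n \<in> I \<longleftrightarrow> x \<in> I" for x n
  proof (induction n arbitrary: x)
    case (Suc n)
    have "x + zn (Suc n) = (x + zn n) + z" by (auto simp: zn_def prod_eq_iff algebra_simps)
    then show ?case using I[of "x + zn n"] Suc by (simp only:)
  qed (simp add: zn_def zero_prod_def[symmetric])
  have level_zn: "level (x + zn n) = level x + int n" for x n
    using z by (simp add: level_def zn_def algebra_simps flip: distrib_left)
  \<comment> \<open>the shift by \<open>n\<close> times \<open>z\<close>, applied to both environments simultaneously\<close>
  define \<tau> where "\<tau> n = (\<lambda>(x, c :: bool). (x + zn n, c))" for n
  have prim: "primary (w \<circ> \<tau> n) = shift (zn n) (primary w)" for w n
    by (auto simp: primary_def \<tau>_def Defs.shift_def)
  have resa: "resampled I (w \<circ> \<tau> n) = shift (zn n) (resampled I w)" for w n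
    by (auto simp: resampled_def \<tau>_def Defs.shift_def zn_I fun_eq_iff)
  have zero_one: "W.prob A = 0 \<or> W.prob A = 1"
  proof (rule zero_one_law_reindex[OF prob_\<mu> A])
    show "inj (\<tau> n)" for n by (auto simp: \<tau>_def inj_def)
    show "\<exists>n. \<tau> n ` J \<inter> J = {}" if "finite J" for J
    proof -
      define m where "m = Max ((\<lambda>p. \<bar>level (fst p)\<bar>) ` J)"
      have m: "\<bar>level (fst p)\<bar> \<le> m" if "p \<in> J" for p
        unfolding m_def using \<open>finite J\<close> that by (intro Max_ge) auto
      have False if "p \<in> J" "\<tau> (nat (2 * m + 1)) p \<in> J" for p
      proof -
        have "level (fst (\<tau> (nat (2 * m + 1)) p)) = level (fst p) + int (nat (2 * m + 1))"
          by (cases p) (simp add: \<tau>_def level_zn)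
        then show False using m[OF that(1)] m[OF that(2)] by auto
      qed
      then show ?thesis by blast
    qed
    show "AE w in W. w \<in> A \<longleftrightarrow> w \<circ> \<tau> n \<in> A" for n
      using AE_primary[OF class_AE(3)[OF K]] AE_resampled[OF class_AE(3)[OF K'], of I] AE_space
    proof eventually_elim
      case (elim w)
      have "w \<circ> \<tau> n \<in> space W" using measurable_space[OF measurable_reindex elim(3)] .
      moreover have "B (primary (w \<circ> \<tau> n)) x y = B (primary w) (x + zn n) (y + zn n)"
        "B' (resampled I (w \<circ> \<tau> n)) x y = B' (resampled I w) (x + zn n) (y + zn n)" for x y
        using elim by (simp_all add: prim resa)
      moreover have "dominated I (\<lambda>x y. b (x + zn n) (y + zn n)) (\<lambda>x y. b' (x + zn n) (y + zn n))
          \<longleftrightarrow> dominated I b b'" for b b'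
      proof -
        have "(\<forall>x\<in>I. R (x + zn n)) \<longleftrightarrow> (\<forall>x\<in>I. R x)" for R
        proof
          assume R: "\<forall>x\<in>I. R (x + zn n)"
          have "R x" if "x \<in> I" for x
            using bspec[OF R, of "x - zn n"] zn_I[of "x - zn n" n] that by simp
          then show "\<forall>x\<in>I. R x" ..
        qed (use zn_I in blast)
        from this[of "\<lambda>x. b x (x + e1) \<le> b' x (x + e1) \<and> b' x (x + e2) \<le> b x (x + e2)"]
        show ?thesis unfolding dominated_def by (simp only: add_ac)
      qed
      ultimately show ?case using elim(3) unfolding A_def by (simp add: dominated_def)
    qed
  qed
  have total: "AE w in W. w \<in> A \<or> dominated I (B' (resampled I w)) (B (primary w))"
    using AE_primary[OF class_AE(1)[OF K]] AE_primary[OF class_AE(2)[OF K]]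
      AE_primary[OF coalescing_AE[OF B]]
      AE_resampled[OF class_AE(1)[OF K'], of I] AE_resampled[OF class_AE(2)[OF K'], of I]
      AE_resampled[OF coalescing_AE[OF B'], of I] AE_space
  proof eventually_elim
    case (elim w)
    have "primary w y = resampled I w y" if "y \<in> I" for y
      using that by (simp add: primary_def resampled_def)
    from dominated_total[OF elim(1,2,4,5) up this] show ?case
      using elim unfolding A_def by blast
  qed
  from zero_one show ?thesis
  proof
    assume "W.prob A = 0"
    then have "AE w in W. w \<notin> A" using A W.prob_eq_0 by blast
    with total have "AE w in W. dominated I (B' (resampled I w)) (B (primary w))"
      by eventually_elim blast
    then show ?thesis ..
  next
    assume "W.prob A = 1"
    then have "AE w in W. w \<in> A" using A W.AE_in_set_eq_1 by blast
    then have "AE w in W. dominated I (B (primary w)) (B' (resampled I w))"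
      by eventually_elim (simp add: A_def)
    then show ?thesis ..
  qed
qed

lemma AE_from_primary:
  assumes "{\<omega> \<in> space P. Q \<omega>} \<in> sets P" "AE w in W. Q (primary w)"
  shows "AE \<omega> in P. Q \<omega>"
  using AE_distr_iff[OF measurable_primary assms(1)] assms(2) by (simp only: distr_primary)

lemma comparison_same_environment:
  assumes B: "B \<in> coalescing_class P" and B': "B' \<in> coalescing_class P"
  shows "(AE \<omega> in P. dominated UNIV (B \<omega>) (B' \<omega>)) \<or> (AE \<omega> in P. dominated UNIV (B' \<omega>) (B \<omega>))"
proof -
  note K = coalescing_in_class[OF B] and K' = coalescing_in_class[OF B']
  note [measurable] = class_measurable[OF K] class_measurable[OF K']
  have "{\<omega> \<in> space P. dominated UNIV (B \<omega>) (B' \<omega>)} \<in> sets P"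
    "{\<omega> \<in> space P. dominated UNIV (B' \<omega>) (B \<omega>)} \<in> sets P"
    by (rule dominated_measurable; measurable)+
  then show ?thesis
    using comparison[OF B B', of UNIV e1] AE_from_primary[of "\<lambda>\<omega>. dominated UNIV (B \<omega>) (B' \<omega>)"]
      AE_from_primary[of "\<lambda>\<omega>. dominated UNIV (B' \<omega>) (B \<omega>)"]
    by (auto simp: resampled_UNIV up_closed_def level_def)
qed

text \<open>
  Equal means of the horizontal increments force the horizontal increments to agree. The
  argument for the vertical ones uses coalescence.
\<close>

lemma dominated_equal_tilt:
  assumes B: "B \<in> coalescing_class P" and B': "B' \<in> coalescing_class P"
    and dom: "AE \<omega> in P. dominated UNIV (B \<omega>) (B' \<omega>)"
    and tilt: "tilt P B \<bullet> e1 = tilt P B' \<bullet> e1"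
  shows "AE \<omega> in P. B \<omega> = B' \<omega>"
proof -
  note K = coalescing_in_class[OF B] and K' = coalescing_in_class[OF B']
  note [measurable] = class_measurable[OF K] class_measurable[OF K']
  have eq1: "AE \<omega> in P. \<forall>x. B \<omega> x (x + e1) = B' \<omega> x (x + e1)"
    unfolding AE_all_countable
  proof
    fix x
    show "AE \<omega> in P. B \<omega> x (x + e1) = B' \<omega> x (x + e1)"
    proof (rule integral_ineq_eq_0_then_AE)
      show "AE \<omega> in P. B \<omega> x (x + e1) \<le> B' \<omega> x (x + e1)"
        using dom by eventually_elim (auto simp: dominated_def)
    qed (simp_all add: class_integrable K K' edge_integral tilt)
  qed
  define A where "A = {\<omega> \<in> space P. B' \<omega> 0 e2 < B \<omega> 0 e2}"
  have A: "A \<in> sets P" unfolding A_def by measurable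
  define \<tau> where "\<tau> n x = x + (int n, 0)" for n and x :: site
  have P_shift: "\<omega> \<circ> \<tau> n = shift (int n, 0) \<omega>" for \<omega> n
    by (auto simp: \<tau>_def Defs.shift_def)
  have in_A: "AE \<omega> in P. shift z \<omega> \<in> A \<longleftrightarrow> B' \<omega> z (z + e2) < B \<omega> z (z + e2)" for z
    using class_AE(3)[OF K] class_AE(3)[OF K'] AE_space
  proof eventually_elim
    case (elim \<omega>)
    have "B \<omega> (0 + z) (e2 + z) = B (shift z \<omega>) 0 e2" "B' \<omega> (0 + z) (e2 + z) = B' (shift z \<omega>) 0 e2"
      using elim by blast+
    then show ?case using measurable_space[OF measurable_shift elim(3)]
      by (simp add: A_def add.commute)
  qed
  have "P.prob A = 0 \<or> P.prob A = 1"
  proof (rule zero_one_law_reindex[OF prob_\<mu> A])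
    show "inj (\<tau> n)" for n by (auto simp: \<tau>_def inj_def)
    show "\<exists>n. \<tau> n ` J \<inter> J = {}" if "finite J" for J
    proof -
      define m where "m = Max ((\<lambda>p. \<bar>fst p\<bar>) ` J)"
      have m: "\<bar>fst p\<bar> \<le> m" if "p \<in> J" for p
        unfolding m_def using \<open>finite J\<close> that by (intro Max_ge) auto
      have False if "p \<in> J" "\<tau> (nat (2 * m + 1)) p \<in> J" for p
        using m[OF that(1)] m[OF that(2)] by (auto simp: \<tau>_def)
      then show ?thesis by blast
    qed
    show "AE w in P. w \<in> A \<longleftrightarrow> w \<circ> \<tau> n \<in> A" for n
      using eq1 class_AE(1)[OF K] class_AE(1)[OF K'] in_A[of "(int n, 0)"] in_A[of 0]
    proof eventually_elim
      case (elim \<omega>)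
      let ?D = "\<lambda>x. B \<omega> x (x + e2) - B' \<omega> x (x + e2)"
      have step: "?D (x + e1) = ?D x" for x
      proof -
        have comm: "x + e1 + e2 = x + e2 + e1" by (simp add: add_ac)
        \<comment> \<open>the cocycle property around a unit square: \<open>?D\<close> is invariant under horizontal steps\<close>
        have sq: "b (x + e1) (x + e1 + e2) - b x (x + e2) = b (x + e2) (x + e2 + e1) - b x (x + e1)"
          if "cocycle b" for b :: "site \<Rightarrow> site \<Rightarrow> real"
          using cocycle_add[OF that, of x "x + e1" "x + e1 + e2"]
            cocycle_add[OF that, of x "x + e2" "x + e2 + e1"]
          unfolding comm by linarith
        show ?thesis
          using sq[OF elim(2)] sq[OF elim(3)] spec[OF elim(1), of x] spec[OF elim(1), of "x + e2"]
          by linarith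
      qed
      have "?D (int k, 0) = ?D 0" for k
      proof (induction k)
        case (Suc k)
        have "(int (Suc k), 0) = (int k, 0) + e1" by simp
        then show ?case using Suc step[of "(int k, 0)"] by (simp only:)
      qed (simp add: zero_prod_def)
      from this[of n] show ?case
        using elim(4,5) unfolding P_shift by (auto simp: Defs.shift_def)
    qed
  qed
  then have "P.prob A = 0"
  proof
    assume "P.prob A = 1"
    then have inA: "AE \<omega> in P. \<omega> \<in> A" using A P.AE_in_set_eq_1 by blast
    have "AE \<omega> in P. \<forall>z. shift z \<omega> \<in> A"
      unfolding AE_all_countable by (intro allI AE_shift inA)
    moreover have "AE \<omega> in P. \<forall>z. shift z \<omega> \<in> A \<longleftrightarrow> B' \<omega> z (z + e2) < B \<omega> z (z + e2)"
      unfolding AE_all_countable by (intro allI in_A)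
    ultimately have "AE \<omega> in P. False"
      using class_AE(2)[OF K] class_AE(2)[OF K'] coalescing_AE[OF B]
    proof eventually_elim
      case (elim \<omega>)
      \<comment> \<open>every path only moves to the right, so paths started in different rows never meet\<close>
      have right: "B \<omega> z (z + e1) \<le> B \<omega> z (z + e2)" for z
      proof -
        have "\<omega> z < B \<omega> z (z + e2)"
          using elim(1,2) recovers_le(2)[OF elim(4), of z] by (blast intro: le_less_trans)
        moreover have "min (B \<omega> z (z + e1)) (B \<omega> z (z + e2)) = \<omega> z"
          using elim(3) unfolding recovers_def by blast
        ultimately show ?thesis by (auto simp: min_def split: if_splits)
      qed
      have snd: "snd (walk (B \<omega>) u n) = snd u" for u n
        by (induction n) (auto simp: right Let_def)
      obtain N where "\<And>i. i \<ge> N \<Longrightarrow> level_path (B \<omega>) 0 i = level_path (B \<omega>) e2 i"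
        using elim(5) unfolding coalesce_def by blast
      then have "level_path (B \<omega>) 0 N = level_path (B \<omega>) e2 N" by blast
      then have "snd (level_path (B \<omega>) 0 N) = snd (level_path (B \<omega>) e2 N)" by (rule arg_cong)
      then show False by (simp add: level_path_def snd)
    qed
    then show ?thesis using P.AE_False by simp
  qed
  then have notA: "AE \<omega> in P. \<omega> \<notin> A" using A P.prob_eq_0 by blast
  have "AE \<omega> in P. \<forall>z. shift z \<omega> \<notin> A"
    unfolding AE_all_countable by (intro allI AE_shift notA)
  moreover have "AE \<omega> in P. \<forall>z. shift z \<omega> \<in> A \<longleftrightarrow> B' \<omega> z (z + e2) < B \<omega> z (z + e2)"
    unfolding AE_all_countable by (intro allI in_A)
  ultimately show ?thesis
    using eq1 dom class_AE(1)[OF K] class_AE(1)[OF K']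
  proof eventually_elim
    case (elim \<omega>)
    have "B \<omega> x y = B' \<omega> x y" for x y
    proof (rule cocycle_eqI[of UNIV])
      fix x
      show "B \<omega> x (x + e1) = B' \<omega> x (x + e1)" using elim(3) by blast
      have "B' \<omega> x (x + e2) \<le> B \<omega> x (x + e2)" using elim(4) unfolding dominated_def by blast
      moreover have "\<not> B' \<omega> x (x + e2) < B \<omega> x (x + e2)" using elim(1,2) by blast
      ultimately show "B \<omega> x (x + e2) = B' \<omega> x (x + e2)" by linarith
    qed (simp_all add: elim(5,6) up_closed_def)
    then show ?case by blast
  qed
qed

lemma dominated_if_tilt_le:
  assumes B: "B \<in> coalescing_class P" and B': "B' \<in> coalescing_class P"
    and tilt: "tilt P B' \<bullet> e1 \<le> tilt P B \<bullet> e1"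
  shows "AE \<omega> in P. dominated UNIV (B \<omega>) (B' \<omega>)"
  using comparison_same_environment[OF B B']
proof
  assume dom: "AE \<omega> in P. dominated UNIV (B' \<omega>) (B \<omega>)"
  note K = coalescing_in_class[OF B] and K' = coalescing_in_class[OF B']
  have "(\<integral>\<omega>. B' \<omega> 0 (0 + e1) \<partial>P) \<le> (\<integral>\<omega>. B \<omega> 0 (0 + e1) \<partial>P)"
  proof (rule integral_mono_AE)
    show "AE \<omega> in P. B' \<omega> 0 (0 + e1) \<le> B \<omega> 0 (0 + e1)"
      using dom unfolding dominated_def by eventually_elim blast
  qed (simp_all only: class_integrable K K')
  then have "tilt P B' \<bullet> e1 = tilt P B \<bullet> e1"
    using tilt unfolding edge_integral(1)[OF K] edge_integral(1)[OF K'] by linarith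
  then have "AE \<omega> in P. B' \<omega> = B \<omega>" by (rule dominated_equal_tilt[OF B' B dom])
  then show ?thesis by eventually_elim (simp add: dominated_def)
qed

text \<open>
  The first component of the tilt determines a coalescing cocycle up to null sets.
\<close>

theorem unique_cocycle:
  assumes "B \<in> coalescing_class P" "B' \<in> coalescing_class P" "tilt P B \<bullet> e1 = tilt P B' \<bullet> e1"
  shows "AE \<omega> in P. B \<omega> = B' \<omega>"
  using assms by (intro dominated_equal_tilt dominated_if_tilt_le) auto

end

section \<open>Forward measurability\<close>

text \<open>
  The \<open>\<sigma>\<close>-algebra generated by the weights at the sites in \<open>J\<close>.
\<close>

definition coordinate_algebra :: "site set \<Rightarrow> env measure" where
  "coordinate_algebra J = sigma UNIV {(\<lambda>\<omega>. \<omega> y) -` A | y A. y \<in> J \<and> A \<in> sets (borel :: real measure)}"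

lemma diff_in_quadrant: "x - u \<in> quadrant \<longleftrightarrow> fst u \<le> fst x \<and> snd u \<le> snd x"
  by (cases x; cases u) (simp add: quadrant_def)

lemma forward_algebra_eq: "forward_algebra u = coordinate_algebra {y. y - u \<in> quadrant}"
  by (simp add: forward_algebra_def coordinate_algebra_def)

lemma space_coordinate_algebra [simp]: "space (coordinate_algebra J) = UNIV"
  by (simp add: coordinate_algebra_def)

lemma measurable_into_coordinate_algebra:
  assumes "\<And>y. y \<in> J \<Longrightarrow> (\<lambda>w. f w y) \<in> borel_measurable N"
  shows "f \<in> measurable N (coordinate_algebra J)"
  unfolding coordinate_algebra_def
proof (rule measurable_measure_of)
  fix X assume "X \<in> {(\<lambda>\<omega>. \<omega> y) -` A | y A. y \<in> J \<and> A \<in> sets (borel :: real measure)}"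
  then obtain y A where X: "X = (\<lambda>\<omega>. \<omega> y) -` A" "y \<in> J" "A \<in> sets borel" by blast
  have "f -` X \<inter> space N = (\<lambda>w. f w y) -` A \<inter> space N" unfolding X(1) by blast
  then show "f -` X \<inter> space N \<in> sets N" using measurable_sets[OF assms[OF X(2)] X(3)] by simp
qed auto

lemma coordinate_measurable:
  assumes "y \<in> J"
  shows "(\<lambda>\<omega>. \<omega> y) \<in> borel_measurable (coordinate_algebra J)"
proof (rule measurableI)
  fix A :: "real set" assume "A \<in> sets borel"
  then show "(\<lambda>\<omega>. \<omega> y) -` A \<inter> space (coordinate_algebra J) \<in> sets (coordinate_algebra J)"
    using assms unfolding coordinate_algebra_def by (auto intro!: sigma_sets.Basic)
qed simp

lemma coordinate_algebra_mono:
  assumes "I \<subseteq> J" "f \<in> borel_measurable (coordinate_algebra I)"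
  shows "f \<in> borel_measurable (coordinate_algebra J)"
proof -
  have "(\<lambda>\<omega>. \<omega>) \<in> measurable (coordinate_algebra J) (coordinate_algebra I)"
    using assms(1) by (intro measurable_into_coordinate_algebra coordinate_measurable) blast
  from measurable_compose[OF this assms(2)] show ?thesis .
qed

context iid_environment
begin

lemma site_measurable [measurable]: "(\<lambda>\<omega>. \<omega> x) \<in> borel_measurable P"
proof -
  have "(\<lambda>\<omega>. \<omega> x) \<in> measurable P \<mu>" by (rule measurable_component_singleton) simp
  then show ?thesis using measurable_cong_sets[OF refl sets_\<mu>] by blast
qed

lemma coordinate_algebra_borel:
  assumes "f \<in> borel_measurable (coordinate_algebra I)"
  shows "f \<in> borel_measurable P"
proof -
  have "(\<lambda>\<omega>. \<omega>) \<in> measurable P (coordinate_algebra I)"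
    by (intro measurable_into_coordinate_algebra site_measurable)
  from measurable_compose[OF this assms] show ?thesis .
qed

lemma borel_coordinate_algebra:
  assumes "f \<in> borel_measurable P"
  shows "f \<in> borel_measurable (coordinate_algebra UNIV)"
proof -
  have sp: "space \<mu> = UNIV" using sets_eq_imp_space_eq[OF sets_\<mu>] by simp
  have "(\<lambda>\<omega>. \<omega>) \<in> measurable (coordinate_algebra UNIV) P"
  proof (rule measurable_PiM_single')
    fix i :: site
    show "(\<lambda>\<omega>. \<omega> i) \<in> measurable (coordinate_algebra UNIV) \<mu>"
      using coordinate_measurable[of i UNIV] measurable_cong_sets[OF refl sets_\<mu>] by blast
  qed (simp add: sp)
  from measurable_compose[OF this assms] show ?thesis .
qed

definition secondary :: "(site \<times> bool \<Rightarrow> real) \<Rightarrow> env" where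
  "secondary w = w \<circ> (\<lambda>x. (x, False))"

text \<open>
  The environment that equals the first argument on \<open>J\<close> and the second one elsewhere.
\<close>

definition splice :: "site set \<Rightarrow> env \<Rightarrow> env \<Rightarrow> env" where
  "splice J \<omega> \<eta> = (\<lambda>x. if x \<in> J then \<omega> x else \<eta> x)"

lemma resampled_eq_splice: "resampled J w = splice J (primary w) (secondary w)"
  by (auto simp: resampled_def splice_def primary_def secondary_def)

lemma measurable_secondary [measurable]: "secondary \<in> measurable W P"
  unfolding secondary_def by measurable

lemma distr_primary_secondary:
  "distr W (P \<Otimes>\<^sub>M P) (\<lambda>w. (primary w, secondary w)) = P \<Otimes>\<^sub>M P"
proof -
  let ?J = "\<lambda>c. (UNIV :: site set) \<times> {c :: bool}"
  have "?J True \<inter> ?J False = {}" by auto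
  from indep_var_restrict_disjoint[OF prob_\<mu> this]
  have ind: "W.indep_var (Pi\<^sub>M (?J True) (\<lambda>_. \<mu>)) (\<lambda>w. restrict w (?J True))
      (Pi\<^sub>M (?J False) (\<lambda>_. \<mu>)) (\<lambda>w. restrict w (?J False))" .
  have meas: "(\<lambda>v x. v (x, c)) \<in> measurable (Pi\<^sub>M (?J c) (\<lambda>_. \<mu>)) P" for c
    by (rule measurable_PiM_single') (auto simp: space_PiM PiE_iff)
  have "W.indep_var P ((\<lambda>v x. v (x, True)) \<circ> (\<lambda>w. restrict w (?J True)))
      P ((\<lambda>v x. v (x, False)) \<circ> (\<lambda>w. restrict w (?J False)))"
    by (rule W.indep_var_compose[OF ind meas meas])
  moreover have "(\<lambda>v x. v (x, True)) \<circ> (\<lambda>w. restrict w (?J True)) = primary"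
    "(\<lambda>v x. v (x, False)) \<circ> (\<lambda>w. restrict w (?J False)) = secondary"
    by (auto simp: primary_def secondary_def fun_eq_iff)
  ultimately have ind: "W.indep_var P primary P secondary" by simp
  have "distr W P secondary = P"
    unfolding secondary_def by (rule distr_reindex[OF prob_\<mu>]) (auto simp: inj_def)
  then show ?thesis
    using ind unfolding W.indep_var_distribution_eq by (simp add: distr_primary)
qed

lemma splice_measurable:
  "(\<lambda>(\<omega>, \<eta>). splice J \<omega> \<eta>) \<in> measurable (coordinate_algebra (I \<inter> J) \<Otimes>\<^sub>M P) (coordinate_algebra I)"
proof (rule measurable_into_coordinate_algebra)
  fix y assume y: "y \<in> I"
  show "(\<lambda>w. (case w of (\<omega>, \<eta>) \<Rightarrow> splice J \<omega> \<eta>) y) \<in> borel_measurable (coordinate_algebra (I \<inter> J) \<Otimes>\<^sub>M P)"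
  proof (cases "y \<in> J")
    case True
    then have "(\<lambda>w. fst w y) \<in> borel_measurable (coordinate_algebra (I \<inter> J) \<Otimes>\<^sub>M P)"
      using y by (intro measurable_compose[OF measurable_fst coordinate_measurable]) auto
    then show ?thesis using True by (simp add: splice_def case_prod_beta')
  next
    case False
    have "(\<lambda>w. snd w y) \<in> borel_measurable (coordinate_algebra (I \<inter> J) \<Otimes>\<^sub>M P)"
      by (intro measurable_compose[OF measurable_snd site_measurable])
    then show ?thesis using False by (simp add: splice_def case_prod_beta')
  qed
qed

text \<open>
  A function of the environment that is unaffected by resampling the weights outside \<open>J\<close> equals,
  almost surely, its average over the resampled weights, which is a genuine function of the weights
  in \<open>J\<close>. If the function is already measurable with respect to the weights in \<open>I\<close>, so is the
  average.
\<close>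

lemma resampling_invariant_measurable:
  fixes g :: "env \<Rightarrow> real"
  assumes g: "g \<in> borel_measurable (coordinate_algebra I)"
    and inv: "AE w in W. g (primary w) = g (resampled J w)"
  obtains h where "h \<in> borel_measurable (coordinate_algebra (I \<inter> J))" "AE \<omega> in P. g \<omega> = h \<omega>"
proof
  interpret PP: pair_sigma_finite P P ..
  have gs: "(\<lambda>(\<omega>, \<eta>). g (splice J \<omega> \<eta>)) \<in> borel_measurable (coordinate_algebra (I \<inter> J) \<Otimes>\<^sub>M P)"
    using measurable_compose[OF splice_measurable g] by (simp add: case_prod_beta')
  then show "(\<lambda>\<omega>. \<integral>\<eta>. g (splice J \<omega> \<eta>) \<partial>P) \<in> borel_measurable (coordinate_algebra (I \<inter> J))"
    by (rule P.borel_measurable_lebesgue_integral)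
  have "(\<lambda>p. (fst p, snd p)) \<in> measurable (P \<Otimes>\<^sub>M P) (coordinate_algebra (I \<inter> J) \<Otimes>\<^sub>M P)"
    by (intro measurable_Pair measurable_snd measurable_compose[OF measurable_fst]
        measurable_into_coordinate_algebra site_measurable)
  from measurable_compose[OF this gs]
  have [measurable]: "(\<lambda>p. g (splice J (fst p) (snd p))) \<in> borel_measurable (P \<Otimes>\<^sub>M P)"
    by simp
  have [measurable]: "g \<in> borel_measurable P" by (rule coordinate_algebra_borel[OF g])
  have m: "{p \<in> space (P \<Otimes>\<^sub>M P). g (fst p) = g (splice J (fst p) (snd p))} \<in> sets (P \<Otimes>\<^sub>M P)"
    by measurable
  have pm: "(\<lambda>w. (primary w, secondary w)) \<in> measurable W (P \<Otimes>\<^sub>M P)" by measurable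
  have "AE p in P \<Otimes>\<^sub>M P. g (fst p) = g (splice J (fst p) (snd p))"
    using AE_distr_iff[OF pm m] inv unfolding distr_primary_secondary
    by (simp add: resampled_eq_splice)
  from PP.AE_pair[OF this] show "AE \<omega> in P. g \<omega> = (\<integral>\<eta>. g (splice J \<omega> \<eta>) \<partial>P)"
  proof eventually_elim
    case (elim \<omega>)
    have "(\<integral>\<eta>. g (splice J \<omega> \<eta>) \<partial>P) = (\<integral>\<eta>. g \<omega> \<partial>P)"
    proof (rule integral_cong_AE)
      have "(\<lambda>\<eta>. (\<omega>, \<eta>)) \<in> measurable P (coordinate_algebra (I \<inter> J) \<Otimes>\<^sub>M P)"
        by (intro measurable_Pair measurable_const) auto
      from measurable_compose[OF this gs]
      show "(\<lambda>\<eta>. g (splice J \<omega> \<eta>)) \<in> borel_measurable P" by simp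
    qed (use elim in auto)
    then show ?case by (simp add: P.prob_space)
  qed
qed

lemma integral_resampled:
  assumes [measurable]: "f \<in> borel_measurable P"
  shows "(\<integral>w. f (resampled I w) \<partial>W) = (\<integral>\<omega>. (f \<omega> :: real) \<partial>P)"
    and "integrable P f \<Longrightarrow> integrable W (\<lambda>w. f (resampled I w))"
  using integral_distr[OF measurable_resampled assms, of I] integrable_distr_eq[OF measurable_resampled assms, of I]
  unfolding distr_resampled by auto

text \<open>
  The two cocycles are ordered inside \<open>I\<close> by \<open>comparison\<close> and have the same one-point laws, hence
  the same means, so they agree inside \<open>I\<close>.
\<close>

lemma cocycle_resampling_invariant:
  assumes B: "B \<in> coalescing_class P"
    and up: "up_closed I" and z: "level z = 1" and I: "\<And>x. x + z \<in> I \<longleftrightarrow> x \<in> I"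
  shows "AE w in W. \<forall>x\<in>I. \<forall>y\<in>I. B (primary w) x y = B (resampled I w) x y"
proof -
  note K = coalescing_in_class[OF B]
  note [measurable] = class_measurable[OF K]
  note int1 = integral_resampled[of "\<lambda>\<omega>. B \<omega> _ _" UNIV, unfolded resampled_UNIV]
    and int2 = integral_resampled[of "\<lambda>\<omega>. B \<omega> _ _" I]
  have edge: "AE w in W. B (primary w) x (x + e) = B (resampled I w) x (x + e)"
    if "(AE w in W. B (primary w) x (x + e) \<le> B (resampled I w) x (x + e)) \<or>
        (AE w in W. B (resampled I w) x (x + e) \<le> B (primary w) x (x + e))" for x e
    using that
  proof
    assume "AE w in W. B (primary w) x (x + e) \<le> B (resampled I w) x (x + e)"
    then show ?thesis
      by (rule integral_ineq_eq_0_then_AE) (simp_all add: int1 int2 class_integrable[OF K])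
  next
    assume "AE w in W. B (resampled I w) x (x + e) \<le> B (primary w) x (x + e)"
    then have "AE w in W. B (resampled I w) x (x + e) = B (primary w) x (x + e)"
      by (rule integral_ineq_eq_0_then_AE) (simp_all add: int1 int2 class_integrable[OF K])
    then show ?thesis by eventually_elim simp
  qed
  have "AE w in W. \<forall>x. x \<in> I \<longrightarrow> B (primary w) x (x + e1) = B (resampled I w) x (x + e1)
      \<and> B (primary w) x (x + e2) = B (resampled I w) x (x + e2)"
    unfolding AE_all_countable
  proof
    fix x
    show "AE w in W. x \<in> I \<longrightarrow> B (primary w) x (x + e1) = B (resampled I w) x (x + e1)
      \<and> B (primary w) x (x + e2) = B (resampled I w) x (x + e2)"
    proof (cases "x \<in> I")
      case True
      have "AE w in W. B (primary w) x (x + e1) = B (resampled I w) x (x + e1)"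
      proof (rule edge, rule disj_forward[OF comparison[OF B B up z I]])
        assume "AE w in W. dominated I (B (primary w)) (B (resampled I w))"
        then show "AE w in W. B (primary w) x (x + e1) \<le> B (resampled I w) x (x + e1)"
          unfolding dominated_def by eventually_elim (use True in blast)
      next
        assume "AE w in W. dominated I (B (resampled I w)) (B (primary w))"
        then show "AE w in W. B (resampled I w) x (x + e1) \<le> B (primary w) x (x + e1)"
          unfolding dominated_def by eventually_elim (use True in blast)
      qed
      moreover have "AE w in W. B (primary w) x (x + e2) = B (resampled I w) x (x + e2)"
      proof (rule edge, rule disj_forward[OF disj_comms(1)[THEN iffD1, OF comparison[OF B B up z I]]])
        assume "AE w in W. dominated I (B (resampled I w)) (B (primary w))"
        then show "AE w in W. B (primary w) x (x + e2) \<le> B (resampled I w) x (x + e2)"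
          unfolding dominated_def by eventually_elim (use True in blast)
      next
        assume "AE w in W. dominated I (B (primary w)) (B (resampled I w))"
        then show "AE w in W. B (resampled I w) x (x + e2) \<le> B (primary w) x (x + e2)"
          unfolding dominated_def by eventually_elim (use True in blast)
      qed
      ultimately show ?thesis by eventually_elim blast
    qed simp
  qed
  with AE_primary[OF class_AE(1)[OF K]] AE_resampled[OF class_AE(1)[OF K], of I]
  show ?thesis
  proof eventually_elim
    case (elim w)
    show ?case
    proof (intro ballI)
      fix x y assume xy: "x \<in> I" "y \<in> I"
      show "B (primary w) x y = B (resampled I w) x y"
        by (rule cocycle_eqI[OF up elim(1,2) _ _ xy]) (simp_all add: elim(3))
    qed
  qed
qed

lemma cocycle_forward_measurable:
  assumes B: "B \<in> coalescing_class P" and "x - u \<in> quadrant" "y - u \<in> quadrant"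
  obtains h where "h \<in> borel_measurable (forward_algebra u)" "AE \<omega> in P. B \<omega> x y = h \<omega>"
proof -
  note K = coalescing_in_class[OF B]
  let ?I = "{v :: site. fst u \<le> fst v}" and ?J = "{v :: site. snd u \<le> snd v}"
  have xy: "x \<in> ?I" "y \<in> ?I" "x \<in> ?J" "y \<in> ?J"
    using assms(2,3) by (auto simp: diff_in_quadrant)
  have "AE w in W. \<forall>x\<in>?I. \<forall>y\<in>?I. B (primary w) x y = B (resampled ?I w) x y"
    by (rule cocycle_resampling_invariant[OF B, of ?I e2]) (auto simp: up_closed_def level_def)
  then have I: "AE w in W. B (primary w) x y = B (resampled ?I w) x y"
    by eventually_elim (use xy in blast)
  have "AE w in W. \<forall>x\<in>?J. \<forall>y\<in>?J. B (primary w) x y = B (resampled ?J w) x y"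
    by (rule cocycle_resampling_invariant[OF B, of ?J e1]) (auto simp: up_closed_def level_def)
  then have J: "AE w in W. B (primary w) x y = B (resampled ?J w) x y"
    by eventually_elim (use xy in blast)
  obtain g where g: "g \<in> borel_measurable (coordinate_algebra (UNIV \<inter> ?I))" "AE \<omega> in P. B \<omega> x y = g \<omega>"
    by (rule resampling_invariant_measurable[OF borel_coordinate_algebra[OF class_measurable[OF K]] I])
  \<comment> \<open>\<open>g\<close> inherits the second invariance because it agrees with the cocycle under both laws\<close>
  have "AE w in W. g (primary w) = g (resampled ?J w)"
    using AE_primary[OF g(2)] AE_resampled[OF g(2), of ?J] J by eventually_elim simp
  then obtain h where h: "h \<in> borel_measurable (coordinate_algebra (UNIV \<inter> ?I \<inter> ?J))" "AE \<omega> in P. g \<omega> = h \<omega>"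
    by (rule resampling_invariant_measurable[OF g(1)])
  have "UNIV \<inter> ?I \<inter> ?J = {y. y - u \<in> quadrant}" by (auto simp: diff_in_quadrant)
  then have "h \<in> borel_measurable (forward_algebra u)" using h(1) by (simp add: forward_algebra_eq)
  moreover have "AE \<omega> in P. B \<omega> x y = h \<omega>" using g(2) h(2) by eventually_elim simp
  ultimately show ?thesis by (rule that)
qed

lemma coalescing_class_cong_AE:
  assumes B: "B \<in> coalescing_class P" and eq: "AE \<omega> in P. C \<omega> = B \<omega>"
    and C: "\<And>x y. (\<lambda>\<omega>. C \<omega> x y) \<in> borel_measurable P"
  shows "C \<in> coalescing_class P" "tilt P C = tilt P B"
proof -
  note K = coalescing_in_class[OF B]
  have eqxy: "AE \<omega> in P. C \<omega> x y = B \<omega> x y" for x y using eq by eventually_elim simp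
  have "AE \<omega> in P. \<forall>z. C (shift z \<omega>) = B (shift z \<omega>)"
    unfolding AE_all_countable by (intro allI AE_shift eq)
  with eq class_AE(3)[OF K]
  have cov: "AE \<omega> in P. \<forall>x y z. C \<omega> (x + z) (y + z) = C (shift z \<omega>) x y"
    by eventually_elim simp
  have "AE \<omega> in P. cocycle (C \<omega>) \<and> recovers (C \<omega>) \<omega>"
    using eq class_AE(1,2)[OF K] by eventually_elim simp
  moreover have "integrable P (\<lambda>\<omega>. C \<omega> x y)" for x y
    using integrable_cong_AE[OF C class_measurable[OF K] eqxy] class_integrable[OF K] by blast
  moreover have "AE \<omega> in P. \<forall>u v. coalesce (level_path (C \<omega>) u) (level_path (C \<omega>) v)"
    using eq coalescing_AE[OF B] by eventually_elim simp
  ultimately show "C \<in> coalescing_class P"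
    using class_joint_measurable[of C, OF C] cov
    unfolding coalescing_class_def cocycle_class_def by simp
  show "tilt P C = tilt P B"
    unfolding tilt_def using integral_cong_AE[OF C class_measurable[OF K] eqxy] by simp
qed

text \<open>
  The choice of a measurable representative is made separately for each pair of sites \<open>x\<close>, \<open>y\<close>,
  with respect to the smallest quadrant containing both.
\<close>

lemma forward_version:
  assumes B: "B \<in> coalescing_class P"
  obtains C where "C \<in> forward_coalescing_class P" "AE \<omega> in P. C \<omega> = B \<omega>"
proof -
  define corner :: "site \<Rightarrow> site \<Rightarrow> site"
    where "corner x y = (min (fst x) (fst y), min (snd x) (snd y))" for x y
  let ?Q = "\<lambda>x y h. h \<in> borel_measurable (forward_algebra (corner x y)) \<and> (AE \<omega> in P. B \<omega> x y = h \<omega>)"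
  define h where "h x y = (SOME h. ?Q x y h)" for x y
  have "\<exists>h. ?Q x y h" for x y
    by (rule cocycle_forward_measurable[OF B, of x "corner x y" y])
       (auto simp: corner_def diff_in_quadrant)
  then have "?Q x y (h x y)" for x y unfolding h_def by (rule someI_ex)
  then have h: "h x y \<in> borel_measurable (forward_algebra (corner x y))"
    "AE \<omega> in P. B \<omega> x y = h x y \<omega>" for x y by blast+
  define C where "C \<omega> x y = h x y \<omega>" for \<omega> x y
  have fwd: "forward_measurable C"
    unfolding forward_measurable_def
  proof (intro allI impI)
    fix u x y :: site assume xy: "x - u \<in> quadrant" "y - u \<in> quadrant"
    have "{v. v - corner x y \<in> quadrant} \<subseteq> {v. v - u \<in> quadrant}"
      using xy by (auto simp: corner_def diff_in_quadrant)
    then show "(\<lambda>\<omega>. C \<omega> x y) \<in> borel_measurable (forward_algebra u)"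
      using h(1)[of x y] unfolding C_def forward_algebra_eq by (rule coordinate_algebra_mono)
  qed
  have C: "(\<lambda>\<omega>. C \<omega> x y) \<in> borel_measurable P" for x y
    using h(1)[of x y] unfolding C_def forward_algebra_eq by (rule coordinate_algebra_borel)
  have "AE \<omega> in P. \<forall>x y. B \<omega> x y = h x y \<omega>"
    unfolding AE_all_countable using h(2) by blast
  then have eq: "AE \<omega> in P. C \<omega> = B \<omega>" by eventually_elim (auto simp: C_def fun_eq_iff)
  have "C \<in> forward_coalescing_class P"
    using fwd coalescing_class_cong_AE(1)[OF B eq C] by (simp add: forward_coalescing_class_def)
  then show ?thesis using eq by (rule that)
qed

end

section \<open>The set of tilts\<close>

lemma inner_e1 [simp]: "h \<bullet> e1 = fst h" and inner_e2 [simp]: "h \<bullet> e2 = snd h"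
  for h :: "real \<times> real"
  by (simp_all add: inner_prod_def)

lemma countable_if_gaps:
  fixes f :: "'a \<Rightarrow> real"
  assumes inj: "inj_on f A"
    and gap: "\<And>h. h \<in> A \<Longrightarrow> \<exists>e>0. \<forall>h'\<in>A. f h' < f h \<longrightarrow> f h' \<le> f h - e"
  shows "countable A"
proof -
  obtain e where e: "\<And>h. h \<in> A \<Longrightarrow> e h > 0"
    "\<And>h h'. h \<in> A \<Longrightarrow> h' \<in> A \<Longrightarrow> f h' < f h \<Longrightarrow> f h' \<le> f h - e h"
    using gap by metis
  have "\<exists>q\<in>\<rat>. f h - e h < q \<and> q < f h" if "h \<in> A" for h
    using e(1)[OF that] by (intro Rats_dense_in_real) simp
  then obtain q where q: "\<And>h. h \<in> A \<Longrightarrow> q h \<in> \<rat> \<and> f h - e h < q h \<and> q h < f h" by metis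
  have less: "q h' < q h" if "h \<in> A" "h' \<in> A" "f h' < f h" for h h'
    using q[OF that(1)] q[OF that(2)] e(2)[OF that] by linarith
  have "inj_on q A"
  proof (rule inj_onI)
    fix h h' assume A: "h \<in> A" "h' \<in> A" and "q h = q h'"
    then have "f h = f h'" using less[of h h'] less[of h' h] by linarith
    then show "h = h'" using inj A by (auto dest: inj_onD)
  qed
  moreover have "countable (q ` A)"
    using q by (intro countable_subset[OF _ countable_rat]) auto
  ultimately show ?thesis by (rule countable_image_inj_on[rotated])
qed

text \<open>
  The tilts on a given side of \<open>h\<close>. The relation \<open>side_less s\<close> below is the strict order by the first
  component, reversed for \<open>s = Plus\<close>, so that these tilts always precede \<open>h\<close>.
\<close>

fun on_side :: "side \<Rightarrow> env measure \<Rightarrow> real \<times> real \<Rightarrow> (real \<times> real) set" where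
  "on_side Minus P h = tilts_left P h"
| "on_side Plus P h = tilts_right P h"

fun side_less :: "side \<Rightarrow> real \<times> real \<Rightarrow> real \<times> real \<Rightarrow> bool" where
  "side_less Minus h' h \<longleftrightarrow> fst h' < fst h"
| "side_less Plus h' h \<longleftrightarrow> fst h < fst h'"

lemma on_side_iff: "h' \<in> on_side s P h \<longleftrightarrow> h' \<in> tilts P \<and> side_less s h' h"
  by (cases s) (auto simp: tilts_left_def tilts_right_def)

lemma one_sided_continuous_iff:
  "one_sided_continuous P B \<longleftrightarrow> (AE \<omega> in P. \<forall>h\<in>tilts P. \<forall>x y s t.
     h islimpt on_side t P h \<longrightarrow>
       ((\<lambda>h'. B h' s \<omega> x y) \<longlongrightarrow> B h t \<omega> x y) (at h within on_side t P h))"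
proof -
  have all_side: "(\<forall>t. Q t) \<longleftrightarrow> Q Minus \<and> Q Plus" for Q by (metis side.exhaust)
  show ?thesis unfolding one_sided_continuous_def all_side[where Q="\<lambda>t. _ islimpt on_side t _ _ \<longrightarrow> _ t"] by simp
qed

declare on_side.simps [simp del]

lemma eventually_side_less:
  assumes "side_less s k h"
  shows "eventually (\<lambda>h'. side_less s k h') (at h within S)"
proof (cases s)
  case Minus
  have "(fst \<longlongrightarrow> fst h) (at h within S)" by (intro tendsto_intros)
  from order_tendstoD(1)[OF this] show ?thesis using assms Minus by simp
next
  case Plus
  have "(fst \<longlongrightarrow> fst h) (at h within S)" by (intro tendsto_intros)
  from order_tendstoD(2)[OF this] show ?thesis using assms Plus by simp
qed

lemma eventually_within: "eventually (\<lambda>h'. h' \<in> S) (at h within S)"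
  by (simp add: eventually_at_filter)

context iid_environment
begin

lemma tilt_inj:
  assumes "h \<in> tilts P" "h' \<in> tilts P" "fst h = fst h'"
  shows "h = h'"
proof -
  obtain B B' where B: "B \<in> coalescing_class P" "tilt P B = h"
    and B': "B' \<in> coalescing_class P" "tilt P B' = h'"
    using assms(1,2) by (auto simp: tilts_def)
  have "AE \<omega> in P. B' \<omega> = B \<omega>"
    using assms(3) B B' by (intro unique_cocycle) auto
  from coalescing_class_cong_AE(2)[OF B(1) this class_measurable[OF coalescing_in_class[OF B'(1)]]]
  show ?thesis using B B' by simp
qed

lemma tilt_antimono:
  assumes "h \<in> tilts P" "h' \<in> tilts P" "fst h \<le> fst h'"
  shows "snd h' \<le> snd h"
proof -
  obtain B B' where B: "B \<in> coalescing_class P" "tilt P B = h"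
    and B': "B' \<in> coalescing_class P" "tilt P B' = h'"
    using assms(1,2) by (auto simp: tilts_def)
  note K = coalescing_in_class[OF B(1)] and K' = coalescing_in_class[OF B'(1)]
  have dom: "AE \<omega> in P. dominated UNIV (B' \<omega>) (B \<omega>)"
    using assms(3) B B' by (intro dominated_if_tilt_le) auto
  have "(\<integral>\<omega>. B \<omega> 0 (0 + e2) \<partial>P) \<le> (\<integral>\<omega>. B' \<omega> 0 (0 + e2) \<partial>P)"
  proof (rule integral_mono_AE)
    show "AE \<omega> in P. B \<omega> 0 (0 + e2) \<le> B' \<omega> 0 (0 + e2)"
      using dom unfolding dominated_def by eventually_elim blast
  qed (simp_all only: class_integrable K K')
  then show ?thesis unfolding edge_integral(2)[OF K] edge_integral(2)[OF K'] by (simp add: B B')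
qed

text \<open>
  By \<open>tilt_inj\<close> and \<open>tilt_antimono\<close>, the function \<open>fst h - snd h\<close> is injective and the distance of two
  tilts is at most the difference of its values. A tilt isolated from one side therefore sits at
  the end of a gap in the range of this function, and disjoint gaps are countable in number.
\<close>

lemma countable_isolated: "countable {h \<in> tilts P. \<not> h islimpt on_side s P h}"
proof -
  define f :: "real \<times> real \<Rightarrow> real"
    where "f h = (case s of Minus \<Rightarrow> fst h - snd h | Plus \<Rightarrow> snd h - fst h)" for h
  have dist: "side_less s h' h \<and> dist h' h \<le> f h - f h'"
    if hh: "h \<in> tilts P" "h' \<in> tilts P" and less: "f h' < f h" for h h'
  proof -
    have "dist h' h \<le> \<bar>fst h' - fst h\<bar> + \<bar>snd h' - snd h\<bar>"
      by (simp add: dist_prod_def dist_real_def sqrt_sum_squares_le_sum_abs)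
    moreover have "fst h < fst h' \<and> snd h' \<le> snd h \<or> fst h' < fst h \<and> snd h \<le> snd h'"
    proof (cases "fst h < fst h'")
      case True
      then show ?thesis using tilt_antimono[OF hh] by simp
    next
      case False
      moreover have "fst h \<noteq> fst h'" using tilt_inj[OF hh] less by blast
      ultimately show ?thesis using tilt_antimono[OF hh(2,1)] by simp
    qed
    ultimately show ?thesis
      using less by (cases s) (auto simp: f_def)
  qed
  show ?thesis
  proof (rule countable_if_gaps[of f])
    show "inj_on f {h \<in> tilts P. \<not> h islimpt on_side s P h}"
    proof (rule inj_onI, goal_cases)
      case (1 h h')
      then have hh: "h \<in> tilts P" "h' \<in> tilts P" and eq: "f h = f h'" by auto
      have "fst h = fst h'"
      proof (cases "fst h \<le> fst h'")
        case True
        then show ?thesis using eq tilt_antimono[OF hh] by (cases s) (auto simp: f_def)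
      next
        case False
        then show ?thesis using eq tilt_antimono[OF hh(2,1)] by (cases s) (auto simp: f_def)
      qed
      then show ?case by (rule tilt_inj[OF hh])
    qed
    fix h assume h: "h \<in> {h \<in> tilts P. \<not> h islimpt on_side s P h}"
    then obtain e where e: "e > 0" "\<And>h'. h' \<in> on_side s P h \<Longrightarrow> h' \<noteq> h \<Longrightarrow> e \<le> dist h' h"
      unfolding islimpt_approachable by (auto simp: not_less)
    have "f h' \<le> f h - e" if "h' \<in> tilts P" "f h' < f h" for h'
      using dist[of h h'] e(2)[of h'] that h by (force simp: on_side_iff)
    then show "\<exists>e>0. \<forall>h'\<in>{h \<in> tilts P. \<not> h islimpt on_side s P h}. f h' < f h \<longrightarrow> f h' \<le> f h - e"
      using e(1) by blast
  qed
qed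

text \<open>
  A countable set of tilts that approaches every one-sided accumulation point \<open>h\<close> of the tilts from
  the same side and contains every tilt that is not such an accumulation point. Accumulation is
  in the plane, not only in the first component.
\<close>

definition skeleton :: "(real \<times> real) set \<Rightarrow> bool" where
  "skeleton D \<longleftrightarrow> countable D \<and> D \<subseteq> tilts P \<and>
     (\<forall>h\<in>tilts P. \<forall>s. (h islimpt on_side s P h \<longrightarrow> h islimpt (D \<inter> on_side s P h)) \<and>
       (\<not> h islimpt on_side s P h \<longrightarrow> h \<in> D))"

text \<open>
  A countable dense set of tilts, together with the countably many tilts isolated from one side. Near
  a tilt \<open>h'\<close> strictly to one side of \<open>h\<close>, all tilts are on the same side of \<open>h\<close>, so density suffices for
  one-sided approximation.
\<close>

lemma skeleton_exists: obtains D where "skeleton D"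
proof -
  obtain T where T: "countable T" "T \<subseteq> tilts P" "tilts P \<subseteq> closure T"
    by (rule separable)
  define D where "D = T \<union> (\<Union>s\<in>{Minus, Plus}. {h \<in> tilts P. \<not> h islimpt on_side s P h})"
  have "countable D" unfolding D_def using T(1) countable_isolated by (intro countable_Un countable_UN) auto
  moreover have "h islimpt (D \<inter> on_side s P h)" if h: "h \<in> tilts P" "h islimpt on_side s P h" for h s
    unfolding islimpt_approachable
  proof (intro allI impI)
    fix e :: real assume "e > 0"
    then obtain h' where h': "h' \<in> on_side s P h" "h' \<noteq> h" "dist h' h < e / 2"
      using h(2) unfolding islimpt_approachable by (meson half_gt_zero)
    have "fst h' \<noteq> fst h" using h' by (cases s) (auto simp: on_side_iff)
    then obtain k where k: "k \<in> T" "dist k h' < min (e / 2) \<bar>fst h' - fst h\<bar>"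
      using h' T(3) \<open>e > 0\<close> unfolding on_side_iff closure_approachable subset_eq
      by (metis half_gt_zero min_less_iff_conj zero_less_abs_iff right_minus_eq)
    have "\<bar>fst k - fst h'\<bar> \<le> dist k h'"
      using dist_fst_le[of k h'] by (simp add: dist_real_def)
    then have "side_less s k h" using k(2) h'(1) by (cases s) (auto simp: on_side_iff)
    then have "k \<in> D \<inter> on_side s P h" "k \<noteq> h"
      using k(1) T(2) by (cases s; auto simp: on_side_iff D_def)+
    moreover have "dist k h < e" using dist_triangle[of k h h'] k(2) h'(3) by simp
    ultimately show "\<exists>x'\<in>D \<inter> on_side s P h. x' \<noteq> h \<and> dist x' h < e" by blast
  qed
  moreover have "h \<in> D" if "h \<in> tilts P" "\<not> h islimpt on_side s P h" for h s
    using that by (cases s) (auto simp: D_def)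
  moreover have "D \<subseteq> tilts P" using T(2) by (auto simp: D_def)
  ultimately show ?thesis by (intro that) (auto simp: skeleton_def)
qed

text \<open>
  A chosen forward measurable coalescing cocycle with tilt \<open>h\<close>.
\<close>

definition version :: "real \<times> real \<Rightarrow> env \<Rightarrow> site \<Rightarrow> site \<Rightarrow> real" where
  "version h = (SOME C. C \<in> forward_coalescing_class P \<and> tilt P C = h)"

lemma version:
  assumes "h \<in> tilts P"
  shows "version h \<in> forward_coalescing_class P" "tilt P (version h) = h"
proof -
  obtain B where B: "B \<in> coalescing_class P" "tilt P B = h" using assms by (auto simp: tilts_def)
  obtain C where C: "C \<in> forward_coalescing_class P" "AE \<omega> in P. C \<omega> = B \<omega>"
    by (rule forward_version[OF B(1)])
  then have "C \<in> coalescing_class P" by (simp add: forward_coalescing_class_def)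
  from coalescing_class_cong_AE(2)[OF B(1) C(2) class_measurable[OF coalescing_in_class[OF this]]]
  have "C \<in> forward_coalescing_class P \<and> tilt P C = h" using B C by simp
  from someI[of "\<lambda>C. C \<in> forward_coalescing_class P \<and> tilt P C = h", OF this]
  show "version h \<in> forward_coalescing_class P" "tilt P (version h) = h"
    unfolding version_def by auto
qed

lemma version_coalescing: "h \<in> tilts P \<Longrightarrow> version h \<in> coalescing_class P"
  using version(1) by (simp add: forward_coalescing_class_def)

lemma version_class: "h \<in> tilts P \<Longrightarrow> version h \<in> cocycle_class P"
  by (rule coalescing_in_class[OF version_coalescing])

lemma version_dominated:
  assumes "h \<in> tilts P" "h' \<in> tilts P" "fst h \<le> fst h'"
  shows "AE \<omega> in P. dominated UNIV (version h' \<omega>) (version h \<omega>)"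
  using assms by (intro dominated_if_tilt_le) (auto simp: version version_coalescing)

text \<open>
  The realisation-wise property of the chosen cocycles on a skeleton on which the construction of
  all one-sided limits rests.
\<close>

definition monotone_family :: "(real \<times> real) set \<Rightarrow> (real \<times> real \<Rightarrow> site \<Rightarrow> site \<Rightarrow> real) \<Rightarrow> bool" where
  "monotone_family D v \<longleftrightarrow> (\<forall>k\<in>D. cocycle (v k)) \<and>
     (\<forall>k\<in>D. \<forall>k'\<in>D. fst k \<le> fst k' \<longrightarrow> dominated UNIV (v k') (v k))"

lemma AE_monotone_family:
  assumes "skeleton D"
  shows "AE \<omega> in P. monotone_family D (\<lambda>k. version k \<omega>)"
proof -
  have D: "countable D" "\<And>k. k \<in> D \<Longrightarrow> k \<in> tilts P" using assms by (auto simp: skeleton_def)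
  have "AE \<omega> in P. \<forall>k\<in>D. cocycle (version k \<omega>)"
    using D by (simp add: AE_ball_countable class_AE(1) version_class)
  moreover have "AE \<omega> in P. \<forall>k\<in>D. \<forall>k'\<in>D. fst k \<le> fst k' \<longrightarrow> dominated UNIV (version k' \<omega>) (version k \<omega>)"
  proof -
    have "AE \<omega> in P. fst k \<le> fst k' \<longrightarrow> dominated UNIV (version k' \<omega>) (version k \<omega>)"
      if "k \<in> D" "k' \<in> D" for k k'
      using version_dominated[OF D(2)[OF that(1)] D(2)[OF that(2)]] by (cases "fst k \<le> fst k'") auto
    then show ?thesis using D(1) by (simp add: AE_ball_countable)
  qed
  ultimately show ?thesis by eventually_elim (simp add: monotone_family_def)
qed

text \<open>
  The skeleton reaches at least as far as \<open>h\<close> in either direction. If \<open>h\<close> is an accumulation point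
  from the far side there is a point of the skeleton beyond \<open>h\<close>; otherwise \<open>h\<close> itself belongs to
  the skeleton.
\<close>

lemma skeleton_bounds:
  assumes "skeleton D" "h \<in> tilts P"
  obtains k where "k \<in> D" "\<not> side_less s k h"
proof (cases "h islimpt on_side (case s of Minus \<Rightarrow> Plus | Plus \<Rightarrow> Minus) P h")
  case True
  then have "h islimpt (D \<inter> on_side (case s of Minus \<Rightarrow> Plus | Plus \<Rightarrow> Minus) P h)"
    using assms by (auto simp: skeleton_def)
  then obtain k where "k \<in> D \<inter> on_side (case s of Minus \<Rightarrow> Plus | Plus \<Rightarrow> Minus) P h"
    by (metis islimpt_EMPTY ex_in_conv)
  then show ?thesis by (intro that[of k]) (cases s; auto simp: on_side_iff)+
next
  case False
  then have "h \<in> D" using assms by (auto simp: skeleton_def)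
  then show ?thesis by (intro that[of h]) (cases s; auto)+
qed

lemma monotone_limit:
  fixes f :: "real \<times> real \<Rightarrow> real"
  assumes lim: "h islimpt (D \<inter> on_side s P h)"
    and mono: "\<And>k k'. k \<in> D \<Longrightarrow> k' \<in> D \<Longrightarrow> side_less s k k' \<Longrightarrow> f k \<le> f k'"
    and bound: "\<And>k. k \<in> D \<inter> on_side s P h \<Longrightarrow> f k \<le> b"
  obtains l where "(f \<longlongrightarrow> l) (at h within (D \<inter> on_side s P h))"
proof
  let ?E = "D \<inter> on_side s P h" 
  have ne: "?E \<noteq> {}" using lim by auto
  have bdd: "bdd_above (f ` ?E)" using bound by (auto intro!: bdd_aboveI)
  show "(f \<longlongrightarrow> (SUP k\<in>?E. f k)) (at h within ?E)"
  proof (rule order_tendstoI)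
    fix a assume "a < (SUP k\<in>?E. f k)"
    then obtain k where k: "k \<in> ?E" "a < f k" using less_cSUP_iff[OF ne bdd] by blast
    then have "eventually (\<lambda>h'. side_less s k h') (at h within ?E)"
      by (intro eventually_side_less) (auto simp: on_side_iff)
    with eventually_within[of ?E h] show "eventually (\<lambda>h'. a < f h') (at h within ?E)"
    proof eventually_elim
      case (elim h')
      then have "f k \<le> f h'" using k(1) by (intro mono) auto
      then show ?case using k(2) by simp
    qed
  next
    fix a assume a: "(SUP k\<in>?E. f k) < a"
    show "eventually (\<lambda>h'. f h' < a) (at h within ?E)"
      using eventually_within[of ?E h]
    proof eventually_elim
      case (elim h')
      then show ?case using a cSUP_upper[OF elim bdd] by simp
    qed
  qed
qed

lemma monotone_family_edge_limit:
  assumes D: "skeleton D" and v: "monotone_family D v"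
    and h: "h \<in> tilts P" "h islimpt on_side s P h"
    and f: "(\<forall>k\<in>D. \<forall>k'\<in>D. fst k \<le> fst k' \<longrightarrow> f k \<le> f k') \<or> (\<forall>k\<in>D. \<forall>k'\<in>D. fst k \<le> fst k' \<longrightarrow> f k' \<le> f k)"
  shows "\<exists>l :: real. (f \<longlongrightarrow> l) (at h within (D \<inter> on_side s P h))"
proof -
  have lim: "h islimpt (D \<inter> on_side s P h)" using D h by (auto simp: skeleton_def)
  have *: "\<exists>l. (g \<longlongrightarrow> l) (at h within (D \<inter> on_side s P h))"
    if g: "\<And>k k'. k \<in> D \<Longrightarrow> k' \<in> D \<Longrightarrow> side_less s k k' \<or> fst k = fst k' \<Longrightarrow> g k \<le> g k'" for g :: "real \<times> real \<Rightarrow> real"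
  proof -
    obtain k where k: "k \<in> D" "\<not> side_less s k h" by (rule skeleton_bounds[OF D h(1)])
    have "g k' \<le> g k" if "k' \<in> D \<inter> on_side s P h" for k'
      using that k by (intro g) (cases s; auto simp: on_side_iff)+
    then show ?thesis using monotone_limit[OF lim, of g "g k"] g by metis
  qed
  have "\<exists>l. (f \<longlongrightarrow> l) (at h within (D \<inter> on_side s P h)) \<or> ((\<lambda>k. - f k) \<longlongrightarrow> l) (at h within (D \<inter> on_side s P h))"
  proof (cases "\<forall>k k'. k \<in> D \<longrightarrow> k' \<in> D \<longrightarrow> side_less s k k' \<or> fst k = fst k' \<longrightarrow> f k \<le> f k'")
    case True
    then show ?thesis using *[of f] by blast
  next
    case False
    then have "\<forall>k k'. k \<in> D \<longrightarrow> k' \<in> D \<longrightarrow> side_less s k k' \<or> fst k = fst k' \<longrightarrow> - f k \<le> - f k'"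
      using f by (cases s) (auto; smt (verit))+
    then show ?thesis using *[of "\<lambda>k. - f k"] by blast
  qed
  then show ?thesis using tendsto_minus_cancel_left by fastforce
qed

end

section \<open>The Busemann process\<close>

lemma dominated_trans: "dominated S a b \<Longrightarrow> dominated S b c \<Longrightarrow> dominated S a c"
  unfolding dominated_def by (blast intro: order_trans)

lemma dominated_limit_left:
  assumes "F \<noteq> bot" "\<And>x y. ((\<lambda>k. v k x y) \<longlongrightarrow> c x y) F" "eventually (\<lambda>k. dominated S (v k) b) F"
  shows "dominated S c b"
  unfolding dominated_def
proof (intro ballI conjI)
  fix x assume x: "x \<in> S"
  show "c x (x + e1) \<le> b x (x + e1)"
    by (rule tendsto_upperbound[OF assms(2) _ assms(1)])
       (use assms(3) in \<open>eventually_elim, use x in \<open>auto simp: dominated_def\<close>\<close>)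
  show "b x (x + e2) \<le> c x (x + e2)"
    by (rule tendsto_lowerbound[OF assms(2) _ assms(1)])
       (use assms(3) in \<open>eventually_elim, use x in \<open>auto simp: dominated_def\<close>\<close>)
qed

lemma dominated_limit_right:
  assumes "F \<noteq> bot" "\<And>x y. ((\<lambda>k. v k x y) \<longlongrightarrow> c x y) F" "eventually (\<lambda>k. dominated S b (v k)) F"
  shows "dominated S b c"
  unfolding dominated_def
proof (intro ballI conjI)
  fix x assume x: "x \<in> S"
  show "b x (x + e1) \<le> c x (x + e1)"
    by (rule tendsto_lowerbound[OF assms(2) _ assms(1)])
       (use assms(3) in \<open>eventually_elim, use x in \<open>auto simp: dominated_def\<close>\<close>)
  show "c x (x + e2) \<le> b x (x + e2)"
    by (rule tendsto_upperbound[OF assms(2) _ assms(1)])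
       (use assms(3) in \<open>eventually_elim, use x in \<open>auto simp: dominated_def\<close>\<close>)
qed

lemma dominated_between:
  assumes "(dominated UNIV a b \<and> dominated UNIV b c) \<or> (dominated UNIV c b \<and> dominated UNIV b a)"
  shows "\<bar>b x (x + e1) - a x (x + e1)\<bar> \<le> \<bar>c x (x + e1) - a x (x + e1)\<bar>"
    "\<bar>b x (x + e2) - a x (x + e2)\<bar> \<le> \<bar>c x (x + e2) - a x (x + e2)\<bar>"
proof -
  have "(a x (x + e1) \<le> b x (x + e1) \<and> b x (x + e1) \<le> c x (x + e1) \<and>
         c x (x + e2) \<le> b x (x + e2) \<and> b x (x + e2) \<le> a x (x + e2)) \<or>
        (c x (x + e1) \<le> b x (x + e1) \<and> b x (x + e1) \<le> a x (x + e1) \<and>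
         a x (x + e2) \<le> b x (x + e2) \<and> b x (x + e2) \<le> c x (x + e2))"
    using assms unfolding dominated_def by blast
  then show "\<bar>b x (x + e1) - a x (x + e1)\<bar> \<le> \<bar>c x (x + e1) - a x (x + e1)\<bar>"
    "\<bar>b x (x + e2) - a x (x + e2)\<bar> \<le> \<bar>c x (x + e2) - a x (x + e2)\<bar>"
    by linarith+
qed

context iid_environment
begin

text \<open>
  A sequence in the skeleton that converges to \<open>h\<close> from the given side; the constant sequence \<open>h\<close>
  if there is none.
\<close>

definition approach :: "(real \<times> real) set \<Rightarrow> side \<Rightarrow> real \<times> real \<Rightarrow> nat \<Rightarrow> real \<times> real" where
  "approach D s h = (if h islimpt on_side s P h
     then (SOME a. (\<forall>n. a n \<in> D \<inter> on_side s P h - {h}) \<and> a \<longlonglongrightarrow> h) else (\<lambda>_. h))"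

text \<open>
  The limit is taken along a sequence of tilts that does not depend on the family \<open>v\<close>. For the family
  \<open>v k = B\<^sup>k(\<omega>)\<close> it is thus a measurable function of \<open>\<omega>\<close> without exceptional null sets, with the
  default value of \<open>lim\<close> where the sequence diverges.
\<close>

definition side_limit ::
    "(real \<times> real \<Rightarrow> site \<Rightarrow> site \<Rightarrow> real) \<Rightarrow> (real \<times> real) set \<Rightarrow> real \<times> real \<Rightarrow> side \<Rightarrow> site \<Rightarrow> site \<Rightarrow> real"
  where "side_limit v D h s x y = lim (\<lambda>n. v (approach D s h n) x y)"

lemma approach:
  assumes D: "skeleton D" and h: "h \<in> tilts P" "h islimpt on_side s P h"
  shows "approach D s h n \<in> D \<inter> on_side s P h - {h}" "approach D s h \<longlonglongrightarrow> h"
proof -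
  have "h islimpt (D \<inter> on_side s P h)" using D h by (auto simp: skeleton_def)
  then have "\<exists>a. (\<forall>n. a n \<in> D \<inter> on_side s P h - {h}) \<and> a \<longlonglongrightarrow> h"
    unfolding islimpt_sequential by blast
  from someI_ex[OF this] show "approach D s h n \<in> D \<inter> on_side s P h - {h}" "approach D s h \<longlonglongrightarrow> h"
    using h(2) by (auto simp: approach_def)
qed

lemma approach_in_skeleton:
  assumes "skeleton D" "h \<in> tilts P"
  shows "approach D s h n \<in> D"
proof (cases "h islimpt on_side s P h")
  case True
  then show ?thesis using approach(1)[OF assms True] by blast
next
  case False
  then show ?thesis using assms by (auto simp: approach_def skeleton_def)
qed

lemma side_limit_isolated:
  "\<not> h islimpt on_side s P h \<Longrightarrow> side_limit v D h s = v h"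
  by (auto simp: side_limit_def approach_def fun_eq_iff)

context
  fixes D v
  assumes D: "skeleton D" and v: "monotone_family D v"
begin

lemma skeleton_filter_nontrivial:
  "h \<in> tilts P \<Longrightarrow> h islimpt on_side s P h \<Longrightarrow> at h within (D \<inter> on_side s P h) \<noteq> bot"
  using D by (auto simp: skeleton_def trivial_limit_within)

lemma side_limit_limit:
  assumes h: "h \<in> tilts P" "h islimpt on_side s P h"
  shows "((\<lambda>k. v k x y) \<longlongrightarrow> side_limit v D h s x y) (at h within (D \<inter> on_side s P h))"
    and "cocycle (side_limit v D h s)"
proof -
  let ?F = "at h within (D \<inter> on_side s P h)"
  have coc: "eventually (\<lambda>k. cocycle (v k)) ?F"
    using v by (intro eventually_mono[OF eventually_within]) (auto simp: monotone_family_def)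
  have dom: "dominated UNIV (v k') (v k)" if "k \<in> D" "k' \<in> D" "fst k \<le> fst k'" for k k'
    using v that by (auto simp: monotone_family_def)
  have lim1: "\<exists>l. ((\<lambda>k. v k x (x + e1)) \<longlongrightarrow> l) ?F" for x
    by (rule monotone_family_edge_limit[OF D v h]) (use dom in \<open>auto simp: dominated_def\<close>)
  have lim2: "\<exists>l. ((\<lambda>k. v k x (x + e2)) \<longlongrightarrow> l) ?F" for x
    by (rule monotone_family_edge_limit[OF D v h]) (use dom in \<open>auto simp: dominated_def\<close>)
  obtain c where c: "cocycle c" "\<And>x y. ((\<lambda>k. v k x y) \<longlongrightarrow> c x y) ?F"
    by (rule edges_convergent[OF coc skeleton_filter_nontrivial[OF h] lim1 lim2]) blast
  have "filterlim (approach D s h) ?F sequentially"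
    using approach[OF D h] by (simp add: filterlim_at)
  then have "(\<lambda>n. v (approach D s h n) x y) \<longlonglongrightarrow> c x y" for x y
    by (rule filterlim_compose[OF c(2)])
  then have "side_limit v D h s = c"
    by (auto simp: side_limit_def fun_eq_iff intro: limI)
  then show "((\<lambda>k. v k x y) \<longlongrightarrow> side_limit v D h s x y) ?F" "cocycle (side_limit v D h s)"
    using c by auto
qed

lemma cocycle_side_limit:
  assumes "h \<in> tilts P"
  shows "cocycle (side_limit v D h s)"
proof (cases "h islimpt on_side s P h")
  case True
  then show ?thesis by (rule side_limit_limit(2)[OF assms])
next
  case False
  then show ?thesis using assms D v
    by (auto simp: side_limit_isolated skeleton_def monotone_family_def)
qed

lemma side_limit_dominated:
  assumes h: "h \<in> tilts P" and k: "k \<in> D"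
  shows "fst k < fst h \<Longrightarrow> dominated UNIV (side_limit v D h s) (v k)"
    and "fst h < fst k \<Longrightarrow> dominated UNIV (v k) (side_limit v D h s)"
proof -
  have dom: "dominated UNIV (v k') (v k)" if "k \<in> D" "k' \<in> D" "fst k \<le> fst k'" for k k'
    using v that by (auto simp: monotone_family_def)
  have "(fst k < fst h \<longrightarrow> dominated UNIV (side_limit v D h s) (v k)) \<and>
        (fst h < fst k \<longrightarrow> dominated UNIV (v k) (side_limit v D h s))"
  proof (cases "h islimpt on_side s P h")
    case True
    let ?F = "at h within (D \<inter> on_side s P h)"
    note F = skeleton_filter_nontrivial[OF h True]
    note lim = side_limit_limit(1)[OF h True]
    show ?thesis
    proof (intro conjI impI)
      assume "fst k < fst h"
      then have "eventually (\<lambda>k'. side_less Minus k k') ?F" by (intro eventually_side_less) simp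
      with eventually_within have "eventually (\<lambda>k'. dominated UNIV (v k') (v k)) ?F"
        by eventually_elim (use dom k in auto)
      then show "dominated UNIV (side_limit v D h s) (v k)" by (rule dominated_limit_left[OF F lim])
    next
      assume "fst h < fst k"
      then have "eventually (\<lambda>k'. side_less Plus k k') ?F" by (intro eventually_side_less) simp
      with eventually_within have "eventually (\<lambda>k'. dominated UNIV (v k) (v k')) ?F"
        by eventually_elim (use dom k in auto)
      then show "dominated UNIV (v k) (side_limit v D h s)" by (rule dominated_limit_right[OF F lim])
    qed
  next
    case False
    then have "h \<in> D" using D h by (auto simp: skeleton_def)
    then show ?thesis using dom k by (simp add: side_limit_isolated[OF False])
  qed
  then show "fst k < fst h \<Longrightarrow> dominated UNIV (side_limit v D h s) (v k)"
    and "fst h < fst k \<Longrightarrow> dominated UNIV (v k) (side_limit v D h s)" by auto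
qed

text \<open>
  At a tilt \<open>h'\<close> between a skeleton point \<open>k\<close> and \<open>h\<close>, the increments of either one-sided limit are
  trapped between those of \<open>v k\<close> and those of the limit at \<open>h\<close> from the side on which \<open>h'\<close> lies.
\<close>

lemma side_limit_continuous:
  assumes h: "h \<in> tilts P" "h islimpt on_side t P h"
  shows "((\<lambda>h'. side_limit v D h' s x y) \<longlongrightarrow> side_limit v D h t x y) (at h within on_side t P h)"
proof (rule edges_tendsto)
  let ?F = "at h within (D \<inter> on_side t P h)" and ?G = "at h within on_side t P h"
  note F = skeleton_filter_nontrivial[OF h]
  show "eventually (\<lambda>h'. cocycle (side_limit v D h' s)) ?G"
    by (rule eventually_mono[OF eventually_within]) (auto intro: cocycle_side_limit simp: on_side_iff)
  show "cocycle (side_limit v D h t)" by (rule cocycle_side_limit[OF h(1)])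
  have between: "eventually (\<lambda>h'.
      \<bar>side_limit v D h' s x (x + e1) - side_limit v D h t x (x + e1)\<bar>
        \<le> \<bar>v k x (x + e1) - side_limit v D h t x (x + e1)\<bar> \<and>
      \<bar>side_limit v D h' s x (x + e2) - side_limit v D h t x (x + e2)\<bar>
        \<le> \<bar>v k x (x + e2) - side_limit v D h t x (x + e2)\<bar>) ?G"
    if k: "k \<in> D \<inter> on_side t P h" for k x
  proof -
    have "eventually (\<lambda>h'. side_less t k h') ?G"
      using k by (intro eventually_side_less) (auto simp: on_side_iff)
    with eventually_within[of "on_side t P h" h] show ?thesis
    proof eventually_elim
      case (elim h')
      then have h': "h' \<in> tilts P" "side_less t h' h" by (auto simp: on_side_iff)
      \<comment> \<open>a skeleton point strictly between \<open>h'\<close> and \<open>h\<close>, through which the limits at \<open>h'\<close> and \<open>h\<close> are compared\<close>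
      have "eventually (\<lambda>k'. k' \<in> D \<inter> on_side t P h \<and> side_less t h' k') ?F"
        by (intro eventually_conj eventually_within eventually_side_less h')
      then obtain k' where k': "k' \<in> D \<inter> on_side t P h" "side_less t h' k'"
        using eventually_happens'[OF F] by blast
      have "side_less t k' h" using k' by (auto simp: on_side_iff)
      then have "(dominated UNIV (side_limit v D h t) (side_limit v D h' s) \<and> dominated UNIV (side_limit v D h' s) (v k))
        \<or> (dominated UNIV (v k) (side_limit v D h' s) \<and> dominated UNIV (side_limit v D h' s) (side_limit v D h t))"
      proof (cases t)
        case Minus
        have "dominated UNIV (side_limit v D h t) (v k')"
          using side_limit_dominated(1)[OF h(1), of k' t] k'(1) \<open>side_less t k' h\<close> Minus by simp
        moreover have "dominated UNIV (v k') (side_limit v D h' s)"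
          using side_limit_dominated(2)[OF h'(1), of k' s] k' Minus by simp
        moreover have "dominated UNIV (side_limit v D h' s) (v k)"
          using side_limit_dominated(1)[OF h'(1), of k s] k elim(2) Minus by simp
        ultimately show ?thesis by (blast intro: dominated_trans)
      next
        case Plus
        have "dominated UNIV (v k') (side_limit v D h t)"
          using side_limit_dominated(2)[OF h(1), of k' t] k'(1) \<open>side_less t k' h\<close> Plus by simp
        moreover have "dominated UNIV (side_limit v D h' s) (v k')"
          using side_limit_dominated(1)[OF h'(1), of k' s] k' Plus by simp
        moreover have "dominated UNIV (v k) (side_limit v D h' s)"
          using side_limit_dominated(2)[OF h'(1), of k s] k elim(2) Plus by simp
        ultimately show ?thesis by (blast intro: dominated_trans)
      qed
      from dominated_between[OF this] show ?case by blast
    qed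
  qed
  have edge: "((\<lambda>h'. side_limit v D h' s x (x + e)) \<longlongrightarrow> side_limit v D h t x (x + e)) ?G"
    if btw: "\<And>k. k \<in> D \<inter> on_side t P h \<Longrightarrow> eventually (\<lambda>h'. \<bar>side_limit v D h' s x (x + e) - side_limit v D h t x (x + e)\<bar>
        \<le> \<bar>v k x (x + e) - side_limit v D h t x (x + e)\<bar>) ?G" for x e
  proof (rule tendstoI)
    fix r :: real assume "r > 0"
    have "eventually (\<lambda>k. k \<in> D \<inter> on_side t P h \<and> dist (v k x (x + e)) (side_limit v D h t x (x + e)) < r) ?F"
      by (intro eventually_conj eventually_within tendstoD[OF side_limit_limit(1)[OF h]] \<open>r > 0\<close>)
    then obtain k where k: "k \<in> D \<inter> on_side t P h" "dist (v k x (x + e)) (side_limit v D h t x (x + e)) < r"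
      using eventually_happens'[OF F] by blast
    show "eventually (\<lambda>h'. dist (side_limit v D h' s x (x + e)) (side_limit v D h t x (x + e)) < r) ?G"
      using btw[OF k(1)] by eventually_elim (use k(2) in \<open>simp add: dist_real_def\<close>)
  qed
  show "((\<lambda>h'. side_limit v D h' s x (x + e1)) \<longlongrightarrow> side_limit v D h t x (x + e1)) ?G" for x
    by (rule edge, rule eventually_mono[OF between]) auto
  show "((\<lambda>h'. side_limit v D h' s x (x + e2)) \<longlongrightarrow> side_limit v D h t x (x + e2)) ?G" for x
    by (rule edge, rule eventually_mono[OF between]) auto
qed

end

text \<open>
  Convergence of the tilts is convergence of the means. Since the differences have a deterministic
  sign, this is convergence in \<open>L\<^sup>1\<close>.
\<close>

lemma version_edges_subsequence:
  assumes k: "\<And>n. k n \<in> tilts P" and h: "h \<in> tilts P" and lim: "k \<longlonglongrightarrow> h" and e: "e = e1 \<or> e = e2"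
  obtains r where "strict_mono r"
    "AE \<omega> in P. (\<lambda>n. version (k (r n)) \<omega> x (x + e)) \<longlonglongrightarrow> version h \<omega> x (x + e)"
proof -
  define u where "u n \<omega> = version (k n) \<omega> x (x + e) - version h \<omega> x (x + e)" for n \<omega>
  have int: "integrable P (u n)" for n
    unfolding u_def by (intro Bochner_Integration.integrable_diff class_integrable version_class k h)
  have sign: "(AE \<omega> in P. 0 \<le> u n \<omega>) \<or> (AE \<omega> in P. u n \<omega> \<le> 0)" for n
  proof -
    have dom: "(AE \<omega> in P. dominated UNIV (version (k n) \<omega>) (version h \<omega>)) \<or>
          (AE \<omega> in P. dominated UNIV (version h \<omega>) (version (k n) \<omega>))"
      using version_dominated[OF k h, of n] version_dominated[OF h k, of n] linear by blast
    from dom show ?thesis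
    proof
      assume "AE \<omega> in P. dominated UNIV (version (k n) \<omega>) (version h \<omega>)"
      then have ae: "AE \<omega> in P. version (k n) \<omega> x (x + e1) \<le> version h \<omega> x (x + e1) \<and>
          version h \<omega> x (x + e2) \<le> version (k n) \<omega> x (x + e2)"
        by (rule eventually_mono) (simp add: dominated_def)
      have "AE \<omega> in P. u n \<omega> \<le> 0" if "e = e1"
        using ae by eventually_elim (simp add: u_def that)
      moreover have "AE \<omega> in P. 0 \<le> u n \<omega>" if "e = e2"
        using ae by eventually_elim (simp add: u_def that)
      ultimately show ?thesis using e by blast
    next
      assume "AE \<omega> in P. dominated UNIV (version h \<omega>) (version (k n) \<omega>)"
      then have ae: "AE \<omega> in P. version h \<omega> x (x + e1) \<le> version (k n) \<omega> x (x + e1) \<and>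
          version (k n) \<omega> x (x + e2) \<le> version h \<omega> x (x + e2)"
        by (rule eventually_mono) (simp add: dominated_def)
      have "AE \<omega> in P. 0 \<le> u n \<omega>" if "e = e1"
        using ae by eventually_elim (simp add: u_def that)
      moreover have "AE \<omega> in P. u n \<omega> \<le> 0" if "e = e2"
        using ae by eventually_elim (simp add: u_def that)
      ultimately show ?thesis using e by blast
    qed
  qed
  have abs_int: "(\<integral>\<omega>. norm (u n \<omega>) \<partial>P) = \<bar>\<integral>\<omega>. u n \<omega> \<partial>P\<bar>" for n
    using sign[of n]
  proof
    assume nn: "AE \<omega> in P. 0 \<le> u n \<omega>"
    then have "(\<integral>\<omega>. norm (u n \<omega>) \<partial>P) = (\<integral>\<omega>. u n \<omega> \<partial>P)"
      using int by (intro integral_cong_AE) (auto elim: eventually_mono)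
    then show ?thesis using integral_nonneg_AE[OF nn] by simp
  next
    assume np: "AE \<omega> in P. u n \<omega> \<le> 0"
    then have "(\<integral>\<omega>. norm (u n \<omega>) \<partial>P) = (\<integral>\<omega>. - u n \<omega> \<partial>P)"
      using int by (intro integral_cong_AE) (auto elim: eventually_mono)
    moreover have "0 \<le> (\<integral>\<omega>. - u n \<omega> \<partial>P)" using np by (intro integral_nonneg_AE) auto
    ultimately show ?thesis by simp
  qed
  have "(\<integral>\<omega>. u n \<omega> \<partial>P) = (if e = e1 then fst h - fst (k n) else snd h - snd (k n))" for n
    unfolding u_def using e
    by (subst Bochner_Integration.integral_diff)
       (auto simp: edge_integral version_class k h version(2) class_integrable)
  moreover have "(\<lambda>n. if e = e1 then fst h - fst (k n) else snd h - snd (k n)) \<longlonglongrightarrow> 0"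
  proof -
    have "(\<lambda>n. fst h - fst (k n)) \<longlonglongrightarrow> fst h - fst h" "(\<lambda>n. snd h - snd (k n)) \<longlonglongrightarrow> snd h - snd h"
      by (intro tendsto_intros lim)+
    then show ?thesis by (cases "e = e1") simp_all
  qed
  ultimately have "(\<lambda>n. \<integral>\<omega>. u n \<omega> \<partial>P) \<longlonglongrightarrow> 0" by simp
  then have "(\<lambda>n. \<integral>\<omega>. norm (u n \<omega>) \<partial>P) \<longlonglongrightarrow> 0"
    unfolding abs_int by (rule tendsto_rabs_zero)
  from tendsto_L1_AE_subseq[OF int this] obtain r where r: "strict_mono r"
    "AE \<omega> in P. (\<lambda>n. u (r n) \<omega>) \<longlonglongrightarrow> 0" by blast
  from r(2) have "AE \<omega> in P. (\<lambda>n. version (k (r n)) \<omega> x (x + e)) \<longlonglongrightarrow> version h \<omega> x (x + e)"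
    by eventually_elim (simp add: u_def LIM_zero_iff)
  with r(1) show ?thesis by (rule that)
qed

text \<open>
  The one-sided limits of the chosen cocycles along the skeleton \<open>D\<close>.
\<close>

definition busemann :: "(real \<times> real) set \<Rightarrow> process" where
  "busemann D h s \<omega> = side_limit (\<lambda>k. version k \<omega>) D h s"

lemma busemann_eq_version:
  assumes D: "skeleton D" and h: "h \<in> tilts P"
  shows "AE \<omega> in P. busemann D h s \<omega> = version h \<omega>"
proof (cases "h islimpt on_side s P h")
  case False
  then show ?thesis by (simp add: busemann_def side_limit_isolated)
next
  case True
  define k where "k = approach D s h"
  have k: "k n \<in> tilts P" for n
    using approach(1)[OF D h True, of n] by (auto simp: k_def on_side_iff)
  have edge: "AE \<omega> in P. busemann D h s \<omega> x (x + e) = version h \<omega> x (x + e)" if e: "e = e1 \<or> e = e2" for x e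
  proof -
    obtain r where r: "strict_mono r"
      "AE \<omega> in P. (\<lambda>n. version (k (r n)) \<omega> x (x + e)) \<longlonglongrightarrow> version h \<omega> x (x + e)"
      by (rule version_edges_subsequence[OF k h approach(2)[OF D h True, folded k_def] e])
    from AE_monotone_family[OF D] r(2) show ?thesis
    proof eventually_elim
      case (elim \<omega>)
      have "filterlim k (at h within (D \<inter> on_side s P h)) sequentially"
        using approach[OF D h True] by (simp add: filterlim_at k_def)
      then have "filterlim (\<lambda>n. k (r n)) (at h within (D \<inter> on_side s P h)) sequentially"
        by (rule filterlim_compose[OF _ filterlim_subseq[OF r(1)]])
      from filterlim_compose[OF side_limit_limit(1)[OF D elim(1) h True] this]
      have "(\<lambda>n. version (k (r n)) \<omega> x (x + e)) \<longlonglongrightarrow> busemann D h s \<omega> x (x + e)"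
        by (simp add: busemann_def)
      then show ?case using elim(2) by (rule LIMSEQ_unique)
    qed
  qed
  have "AE \<omega> in P. \<forall>x. busemann D h s \<omega> x (x + e1) = version h \<omega> x (x + e1)"
    "AE \<omega> in P. \<forall>x. busemann D h s \<omega> x (x + e2) = version h \<omega> x (x + e2)"
    unfolding AE_all_countable using edge by blast+
  with AE_monotone_family[OF D] class_AE(1)[OF version_class[OF h]] show ?thesis
  proof eventually_elim
    case (elim \<omega>)
    have coc: "cocycle (busemann D h s \<omega>)"
      unfolding busemann_def by (rule cocycle_side_limit[OF D elim(1) h])
    have "busemann D h s \<omega> x y = version h \<omega> x y" for x y
      by (rule cocycle_eqI[OF _ coc elim(2), of UNIV]) (simp_all add: up_closed_def elim(3,4))
    then show ?case by blast
  qed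
qed

lemma busemann_forward_measurable:
  assumes D: "skeleton D" and h: "h \<in> tilts P"
  shows "forward_measurable (busemann D h s)"
  unfolding forward_measurable_def
proof (intro allI impI)
  fix u x y :: site assume xy: "x - u \<in> quadrant" "y - u \<in> quadrant"
  have "(\<lambda>\<omega>. version (approach D s h n) \<omega> x y) \<in> borel_measurable (forward_algebra u)" for n
  proof -
    have "approach D s h n \<in> tilts P"
      using approach_in_skeleton[OF D h] D by (auto simp: skeleton_def)
    from version(1)[OF this] show ?thesis
      using xy by (auto simp: forward_coalescing_class_def forward_measurable_def)
  qed
  then show "(\<lambda>\<omega>. busemann D h s \<omega> x y) \<in> borel_measurable (forward_algebra u)"
    unfolding busemann_def side_limit_def by (rule borel_measurable_lim_metric)
qed

lemma forward_measurable_borel: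
  assumes "forward_measurable B"
  shows "(\<lambda>\<omega>. B \<omega> x y) \<in> borel_measurable P"
proof -
  define u where "u = (min (fst x) (fst y), min (snd x) (snd y))"
  have "x - u \<in> quadrant" "y - u \<in> quadrant" by (auto simp: diff_in_quadrant u_def)
  then have "(\<lambda>\<omega>. B \<omega> x y) \<in> borel_measurable (forward_algebra u)"
    using assms by (auto simp: forward_measurable_def)
  then show ?thesis unfolding forward_algebra_eq by (rule coordinate_algebra_borel)
qed

lemma busemann_process_busemann:
  assumes D: "skeleton D"
  shows "busemann_process P (busemann D)"
  unfolding busemann_process_def
proof (intro conjI)
  show "\<forall>h\<in>tilts P. \<forall>s x y. (\<lambda>\<omega>. busemann D h s \<omega> x y) \<in> borel_measurable P"
    using busemann_forward_measurable[OF D] forward_measurable_borel by blast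
  show "no_sign_distinction P (busemann D)"
    unfolding no_sign_distinction_def
  proof
    fix h assume h: "h \<in> tilts P"
    show "AE \<omega> in P. busemann D h Minus \<omega> = busemann D h Plus \<omega>"
      using busemann_eq_version[OF D h, of Minus] busemann_eq_version[OF D h, of Plus]
      by eventually_elim simp
  qed
  show "busemann_with_mean P (busemann D)"
    unfolding busemann_with_mean_def
  proof (intro ballI exI conjI)
    fix h assume h: "h \<in> tilts P"
    show "common_cocycle (busemann D) h (busemann D h Minus)" by (auto simp: common_cocycle_def)
    note fwd = busemann_forward_measurable[OF D h, of Minus]
    note cong = coalescing_class_cong_AE[OF version_coalescing[OF h]
        busemann_eq_version[OF D h, of Minus] forward_measurable_borel[OF fwd]]
    show "busemann D h Minus \<in> forward_coalescing_class P"
      using cong(1) fwd by (simp add: forward_coalescing_class_def)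
    have "tilt P (busemann D h Minus) = h" using cong(2) version(2)[OF h] by simp
    then show "(\<integral>\<omega>. busemann D h Minus \<omega> 0 e1 \<partial>P) = - (h \<bullet> e1)"
      "(\<integral>\<omega>. busemann D h Minus \<omega> 0 e2 \<partial>P) = - (h \<bullet> e2)"
      unfolding tilt_def by (metis inner_e1 inner_e2 fst_conv snd_conv minus_minus)+
  qed
  show "monotone_process P (busemann D)"
    unfolding monotone_process_def
  proof (intro ballI impI allI)
    fix h h' :: "real \<times> real" and x :: site
    assume h: "h \<in> tilts P" "h' \<in> tilts P" and le: "h \<bullet> e1 \<le> h' \<bullet> e1"
    have "AE \<omega> in P. dominated UNIV (version h' \<omega>) (version h \<omega>)"
      using le by (intro version_dominated[OF h]) simp
    with busemann_eq_version[OF D h(1), of Minus] busemann_eq_version[OF D h(1), of Plus]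
      busemann_eq_version[OF D h(2), of Minus] busemann_eq_version[OF D h(2), of Plus]
    show "AE \<omega> in P.
        busemann D h Minus \<omega> x (x + e1) \<ge> busemann D h Plus \<omega> x (x + e1) \<and>
        busemann D h Plus \<omega> x (x + e1) \<ge> busemann D h' Minus \<omega> x (x + e1) \<and>
        busemann D h' Minus \<omega> x (x + e1) \<ge> busemann D h' Plus \<omega> x (x + e1) \<and>
        busemann D h Minus \<omega> x (x + e2) \<le> busemann D h Plus \<omega> x (x + e2) \<and>
        busemann D h Plus \<omega> x (x + e2) \<le> busemann D h' Minus \<omega> x (x + e2) \<and>
        busemann D h' Minus \<omega> x (x + e2) \<le> busemann D h' Plus \<omega> x (x + e2)"
      by eventually_elim (simp add: dominated_def)
  qed
  show "one_sided_continuous P (busemann D)"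
    unfolding one_sided_continuous_iff
    using AE_monotone_family[OF D]
  proof eventually_elim
    case (elim \<omega>)
    show ?case unfolding busemann_def by (intro ballI allI impI side_limit_continuous[OF D elim])
  qed
qed

lemma process_eq_version:
  assumes B: "busemann_process P B" and h: "h \<in> tilts P"
  shows "AE \<omega> in P. B h s \<omega> = version h \<omega>"
proof -
  obtain C where C: "common_cocycle B h C" "C \<in> forward_coalescing_class P"
    "(\<integral>\<omega>. C \<omega> 0 e1 \<partial>P) = - (h \<bullet> e1)"
    using B h unfolding busemann_process_def busemann_with_mean_def by blast
  have "C \<in> coalescing_class P" using C(2) by (simp add: forward_coalescing_class_def)
  moreover have "tilt P C \<bullet> e1 = tilt P (version h) \<bullet> e1"
    using C(3) version(2)[OF h] by (simp add: tilt_def)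
  ultimately have "AE \<omega> in P. C \<omega> = version h \<omega>"
    by (intro unique_cocycle version_coalescing[OF h])
  moreover have "AE \<omega> in P. B h Minus \<omega> = B h Plus \<omega>"
    using B h by (auto simp: busemann_process_def no_sign_distinction_def)
  ultimately show ?thesis
  proof eventually_elim
    case (elim \<omega>)
    then have "C \<omega> = B h Minus \<omega>" "C \<omega> = B h Plus \<omega>"
      using C(1) unfolding common_cocycle_def by blast+
    then show ?case using elim by (cases s) auto
  qed
qed

lemma busemann_process_unique:
  assumes B: "busemann_process P B" and B': "busemann_process P B'"
  shows "AE \<omega> in P. \<forall>x y. \<forall>h\<in>tilts P. \<forall>s. B h s \<omega> x y = B' h s \<omega> x y"
proof -
  obtain D where D: "skeleton D" by (rule skeleton_exists)
  have eq: "AE \<omega> in P. \<forall>k\<in>D. B k s \<omega> = B' k s \<omega>" for s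
  proof -
    have "AE \<omega> in P. B k s \<omega> = B' k s \<omega>" if "k \<in> D" for k
    proof -
      have k: "k \<in> tilts P" using that D by (auto simp: skeleton_def)
      show ?thesis
        using process_eq_version[OF B k, of s] process_eq_version[OF B' k, of s] by eventually_elim simp
    qed
    moreover have "countable D" using D by (simp add: skeleton_def)
    ultimately show ?thesis by (simp add: AE_ball_countable)
  qed
  have cont: "one_sided_continuous P B" "one_sided_continuous P B'"
    using B B' by (auto simp: busemann_process_def)
  from eq[of Minus] eq[of Plus] cont[unfolded one_sided_continuous_iff] show ?thesis
  proof eventually_elim
    case (elim \<omega>)
    show ?case
    proof (intro allI ballI)
      fix x y h s assume h: "h \<in> tilts P"
      show "B h s \<omega> x y = B' h s \<omega> x y"
      proof (cases "h islimpt on_side s P h")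
        case True
        let ?F = "at h within (D \<inter> on_side s P h)"
        have "?F \<noteq> bot" using D h True by (auto simp: skeleton_def trivial_limit_within)
        moreover have "((\<lambda>k. B k Plus \<omega> x y) \<longlongrightarrow> B h s \<omega> x y) ?F"
          using elim(3) h True by (blast intro: tendsto_within_subset)
        moreover have "((\<lambda>k. B k Plus \<omega> x y) \<longlongrightarrow> B' h s \<omega> x y) ?F"
        proof (rule Lim_transform_eventually)
          show "((\<lambda>k. B' k Plus \<omega> x y) \<longlongrightarrow> B' h s \<omega> x y) ?F"
            using elim(4) h True by (blast intro: tendsto_within_subset)
          show "eventually (\<lambda>k. B' k Plus \<omega> x y = B k Plus \<omega> x y) ?F"
            using eventually_within by (rule eventually_mono) (use elim(2) in auto)
        qed
        ultimately show ?thesis by (rule tendsto_unique)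
      next
        case False
        then have "h \<in> D" using D h by (auto simp: skeleton_def)
        then show ?thesis using elim(1,2) by (cases s) auto
      qed
    qed
  qed
qed

end

theorem theorem3p10:
  fixes \<mu> :: "real measure" and P :: "env measure" and \<epsilon> :: real
  assumes "prob_space \<mu>" and "sets \<mu> = sets borel"
    and "P = Pi\<^sub>M UNIV (\<lambda>_. \<mu>)"
    and "\<epsilon> > 0" and "integrable P (\<lambda>\<omega>. \<bar>\<omega> 0\<bar> powr (2 + \<epsilon>))"
    and "(\<integral>\<omega>. (\<omega> 0)\<^sup>2 \<partial>P) > (\<integral>\<omega>. \<omega> 0 \<partial>P)\<^sup>2"
  shows "(\<exists>B. busemann_process P B) \<and>
    (\<forall>B B'. busemann_process P B \<longrightarrow> busemann_process P B' \<longrightarrow>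
       (AE \<omega> in P. \<forall>x y. \<forall>h\<in>tilts P. \<forall>s. B h s \<omega> x y = B' h s \<omega> x y))"
proof -
  interpret E: iid_environment \<mu> by (rule iid_environment.intro; fact)
  obtain D where "E.skeleton D" by (rule E.skeleton_exists)
  then have "busemann_process P (E.busemann D)"
    unfolding assms(3) by (rule E.busemann_process_busemann)
  then show ?thesis using E.busemann_process_unique unfolding assms(3) by blast
qed

end
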